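(* Consider Prox-DFinito with convex, $L$-smooth $f_1,\dots,f_n$, step-size $0<\alpha\le\frac2L$, damping parameter $\theta\in(0,1)$, initialization $\boldsymbol{z}^0\neq\boldsymbol{z}^\star$, and cyclic sampling with an optimal cyclic order $\pi^\star$. If $\rho:=\frac{\|\boldsymbol{z}^0-\boldsymbol{z}^\star\|_{\pi^\star}^2}{\|\boldsymbol{z}^0-\boldsymbol{z}^\star\|^2}=\mathcal{O}(1/n)$, then the method achieves sample complexity $\tilde{\mathcal{O}}(L^2/\epsilon)$. Precisely: for all constants $c_1,c_2,c_3>0$ and $\theta\in(0,1)$ there is a constant $C>0$ depending only on $c_1,c_2,c_3,\theta$ such that, whenever $\frac1n\|\boldsymbol{z}^0-\boldsymbol{z}^\star\|^2\le c_1$, $\rho\le c_2/n$ and $\alpha\ge c_3/L$, for every $\epsilon>0$ there is an epoch index $k\ge0$ with $$nk\le C\,(\log(n)+1)\,\frac{L^2}{\epsilon}\qquad\text{and}\qquad \min_{g\in\partial r(x^{kn})}\|\nabla F(x^{kn})+g\|^2\le\epsilon ,$$ where $nk$ is the number of individual gradient evaluations used to produce $x^{kn}$.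
   Context: Problem: $\min_{x\in\mathbb{R}^d}F(x)+r(x)$ with $F=\frac1n\sum_{i=1}^n f_i$, each $f_i$ differentiable and convex, and $r:\mathbb{R}^d\to\mathbb{R}\cup\{+\infty\}$ convex, closed and proper (not necessarily differentiable), with subdifferential $\partial r$. $[n]=\{1,\dots,n\}$; $L>0$, and $L$-smooth means the gradient is $L$-Lipschitz. $\mathrm{prox}_{\alpha r}(x)=\arg\min_{y}\{\alpha r(y)+\frac12\|y-x\|^2\}$. A minimizer $x^\star$ of $F+r$ is assumed to exist, and $\boldsymbol{z}^\star=\mathrm{col}\{z_1^\star,\dots,z_n^\star\}\in\mathbb{R}^{nd}$ (stacked vector) with $z_i^\star=x^\star-\alpha\nabla f_i(x^\star)$. Order-specific norm: for a permutation $\pi$ of $[n]$ and $\boldsymbol{z}=\mathrm{col}\{z_1,\dots,z_n\}\in\mathbb{R}^{nd}$, $\|\boldsymbol{z}\|_\pi^2=\sum_{i=1}^n\frac{i}{n}\|z_{\pi(i)}\|^2$. An optimal cyclic order is $\pi^\star\in\arg\min_\pi\|\boldsymbol{z}^0-\boldsymbol{z}^\star\|_\pi^2$. Prox-DFinito: given $\boldsymbol{z}^0=\mathrm{col}\{z_1^0,\dots,z_n^0\}$, set $\bar z^0=\frac1n\sum_i z_i^0$. For each epoch $k=0,1,2,\dots$: for $t=kn+1,\dots,(k+1)n$, set $x^{t-1}=\mathrm{prox}_{\alpha r}(\bar z^{t-1})$, pick an index $i_t$, set $z_{i_t}^t=x^{t-1}-\alpha\nabla f_{i_t}(x^{t-1})$,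 $z_i^t=z_i^{t-1}$ for $i\ne i_t$, and $\bar z^t=\bar z^{t-1}+(z_{i_t}^t-z_{i_t}^{t-1})/n$. At the end of the epoch apply the damping step: overwrite $z_i^{(k+1)n}\leftarrow(1-\theta)z_i^{kn}+\theta z_i^{(k+1)n}$ for all $i$ and $\bar z^{(k+1)n}\leftarrow(1-\theta)\bar z^{kn}+\theta\bar z^{(k+1)n}$. Thus $x^{kn}=\mathrm{prox}_{\alpha r}(\bar z^{kn})$ with the damped $\bar z^{kn}$. Cyclic sampling with order $\pi$: $i_{kn+j}=\pi(j)$ for all epochs $k$ and $j\in[n]$. The notation $\tilde{\mathcal{O}}$ hides the $\log(n)$ factor. *)

theory Defs
  imports "HOL-Analysis.Analysis"
begin

section \<open>All the spaces \<open>R^d\<close> inside one type\<close>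

text \<open>
  The constant of the theorem must not depend on the dimension \<open>d\<close>, so \<open>d\<close> has to be quantified
  inside the formula and cannot be encoded in a type. We therefore use the inner product space of
  finitely supported real sequences and realise \<open>R^d\<close>, with its usual inner product, as the
  subspace of the sequences that vanish from index \<open>d\<close> on (lemmas \<open>inner_Rn\<close> and \<open>ex1_Rn\<close>).
  The library's \<open>poly_mapping\<close> is not usable here because it carries the l1-norm.
\<close>

typedef fseq = "{x :: nat \<Rightarrow> real. finite {i. x i \<noteq> 0}}"
  morphisms coord Abs_fseq
  by (rule exI[of _ "\<lambda>_. 0"]) simp

lemma finite_support [simp]: "finite {i. coord x i \<noteq> 0}"
  using coord[of x] by simp

lemma coord_Abs: "finite {i. x i \<noteq> 0} \<Longrightarrow> coord (Abs_fseq x) = x"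
  by (simp add: Abs_fseq_inverse)

lemma fseq_eq_iff: "x = y \<longleftrightarrow> (\<forall>i. coord x i = coord y i)"
  by (metis coord_inject ext)

instantiation fseq :: real_vector
begin

definition "0 = Abs_fseq (\<lambda>_. 0)"
definition "x + y = Abs_fseq (\<lambda>i. coord x i + coord y i)"
definition "- x = Abs_fseq (\<lambda>i. - coord x i)"
definition "x - y = Abs_fseq (\<lambda>i. coord x i - coord y i)"
definition "a *\<^sub>R x = Abs_fseq (\<lambda>i. a * coord x i)"

lemma coord_zero [simp]: "coord 0 i = 0"
  by (simp add: zero_fseq_def coord_Abs)

lemma coord_add [simp]: "coord (x + y) i = coord x i + coord y i"
proof -
  have "finite {i. coord x i + coord y i \<noteq> 0}"
    by (rule finite_subset[of _ "{i. coord x i \<noteq> 0} \<union> {i. coord y i \<noteq> 0}"]) auto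
  then show ?thesis by (simp add: plus_fseq_def coord_Abs)
qed

lemma coord_uminus [simp]: "coord (- x) i = - coord x i"
  by (simp add: uminus_fseq_def coord_Abs)

lemma coord_diff [simp]: "coord (x - y) i = coord x i - coord y i"
proof -
  have "finite {i. coord x i - coord y i \<noteq> 0}"
    by (rule finite_subset[of _ "{i. coord x i \<noteq> 0} \<union> {i. coord y i \<noteq> 0}"]) auto
  then show ?thesis by (simp add: minus_fseq_def coord_Abs)
qed

lemma coord_scaleR [simp]: "coord (a *\<^sub>R x) i = a * coord x i"
proof -
  have "finite {i. a * coord x i \<noteq> 0}"
    by (rule finite_subset[of _ "{i. coord x i \<noteq> 0}"]) auto
  then show ?thesis by (simp add: scaleR_fseq_def coord_Abs)
qed

instance
  by standard (auto simp: fseq_eq_iff algebra_simps)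

end

instantiation fseq :: real_inner
begin

definition "inner x y = (\<Sum>i | coord x i \<noteq> 0. coord x i * coord y i)"
definition "norm (x :: fseq) = sqrt (inner x x)"
definition "sgn (x :: fseq) = x /\<^sub>R norm x"
definition "dist (x :: fseq) y = norm (x - y)"
definition [code del]:
  "(uniformity :: (fseq \<times> fseq) filter) = (INF e\<in>{0<..}. principal {(x, y). dist x y < e})"
definition [code del]:
  "open (U :: fseq set) \<longleftrightarrow> (\<forall>x\<in>U. eventually (\<lambda>(x', y). x' = x \<longrightarrow> y \<in> U) uniformity)"

lemma inner_fseq_superset:
  assumes "finite A" and "{i. coord x i \<noteq> 0} \<subseteq> A"
  shows "inner x y = (\<Sum>i\<in>A. coord x i * coord y i)"
  unfolding inner_fseq_def by (rule sum.mono_neutral_left) (use assms in auto)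

instance
proof
  fix x y z :: fseq and a :: real
  show "inner x y = inner y x"
  proof -
    let ?A = "{i. coord x i \<noteq> 0} \<union> {i. coord y i \<noteq> 0}"
    have "inner x y = (\<Sum>i\<in>?A. coord x i * coord y i)"
      by (rule inner_fseq_superset) auto
    moreover have "inner y x = (\<Sum>i\<in>?A. coord y i * coord x i)"
      by (rule inner_fseq_superset) auto
    ultimately show ?thesis by (simp add: mult.commute)
  qed
  show "inner (x + y) z = inner x z + inner y z"
  proof -
    let ?A = "{i. coord x i \<noteq> 0} \<union> {i. coord y i \<noteq> 0}"
    have "inner (x + y) z = (\<Sum>i\<in>?A. coord (x + y) i * coord z i)"
      by (rule inner_fseq_superset) auto
    moreover have "inner x z = (\<Sum>i\<in>?A. coord x i * coord z i)"
      by (rule inner_fseq_superset) auto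
    moreover have "inner y z = (\<Sum>i\<in>?A. coord y i * coord z i)"
      by (rule inner_fseq_superset) auto
    ultimately show ?thesis by (simp add: algebra_simps sum.distrib)
  qed
  show "inner (a *\<^sub>R x) y = a * inner x y"
  proof -
    have "inner (a *\<^sub>R x) y = (\<Sum>i\<in>{i. coord x i \<noteq> 0}. coord (a *\<^sub>R x) i * coord y i)"
      by (rule inner_fseq_superset) auto
    then show ?thesis by (simp add: inner_fseq_def sum_distrib_left mult.assoc)
  qed
  show "0 \<le> inner x x"
    by (simp add: inner_fseq_def sum_nonneg)
  show "inner x x = 0 \<longleftrightarrow> x = 0"
    by (auto simp: inner_fseq_def sum_nonneg_eq_0_iff fseq_eq_iff)
qed (simp_all add: norm_fseq_def sgn_fseq_def dist_fseq_def uniformity_fseq_def open_fseq_def)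

end

definition Rn :: "nat \<Rightarrow> fseq set" where
  "Rn d = {x. \<forall>i\<ge>d. coord x i = 0}"

lemma subspace_Rn: "subspace (Rn d)"
  by (auto simp: Rn_def subspace_def)

lemma inner_Rn: "x \<in> Rn d \<Longrightarrow> x \<bullet> y = (\<Sum>i<d. coord x i * coord y i)"
  by (rule inner_fseq_superset) (auto simp: Rn_def not_le[symmetric])

lemma ex1_Rn: "\<exists>!x. x \<in> Rn d \<and> (\<forall>i<d. coord x i = v i)"
proof -
  have "finite {i. (if i < d then v i else 0) \<noteq> 0}"
    by (rule finite_subset[of _ "{..<d}"]) (auto split: if_splits)
  then have "coord (Abs_fseq (\<lambda>i. if i < d then v i else 0)) = (\<lambda>i. if i < d then v i else 0)"
    by (rule coord_Abs)
  then show ?thesis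
    by (intro ex1I[of _ "Abs_fseq (\<lambda>i. if i < d then v i else 0)"])
       (auto simp: Rn_def fseq_eq_iff not_less[symmetric])
qed


section \<open>Convex analysis on a subspace\<close>

text \<open>
  In what follows \<open>E\<close> is the ambient Euclidean space (\<open>Rn d\<close> in the theorem). Only the values on
  \<open>E\<close> of a function are relevant.
\<close>

text \<open>Requiring \<open>g \<in> E\<close> makes the gradient unique: derivatives within \<open>E\<close> only see directions in \<open>E\<close>.\<close>

definition grad :: "'a::real_inner set \<Rightarrow> ('a \<Rightarrow> real) \<Rightarrow> 'a \<Rightarrow> 'a" where
  "grad E f x = (THE g. g \<in> E \<and> (f has_derivative (\<lambda>h. g \<bullet> h)) (at x within E))"

definition smooth :: "'a::real_inner set \<Rightarrow> real \<Rightarrow> ('a \<Rightarrow> real) \<Rightarrow> bool" where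
  "smooth E L f \<longleftrightarrow> f differentiable_on E \<and> L-lipschitz_on E (grad E f)"

definition proper_ext :: "'a set \<Rightarrow> ('a \<Rightarrow> ereal) \<Rightarrow> bool" where
  "proper_ext E r \<longleftrightarrow> (\<forall>x\<in>E. r x \<noteq> -\<infinity>) \<and> (\<exists>x\<in>E. r x \<noteq> \<infinity>)"

definition convex_ext :: "'a::real_vector set \<Rightarrow> ('a \<Rightarrow> ereal) \<Rightarrow> bool" where
  "convex_ext E r \<longleftrightarrow>
    (\<forall>x\<in>E. \<forall>y\<in>E. \<forall>u\<ge>0. \<forall>v\<ge>0. u + v = 1 \<longrightarrow>
      r (u *\<^sub>R x + v *\<^sub>R y) \<le> ereal u * r x + ereal v * r y)"

text \<open>A function is closed if its epigraph is closed.\<close>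

definition closed_ext :: "'a::topological_space set \<Rightarrow> ('a \<Rightarrow> ereal) \<Rightarrow> bool" where
  "closed_ext E r \<longleftrightarrow> closed {(x, t :: real). x \<in> E \<and> r x \<le> ereal t}"

text \<open>For proper \<open>r\<close> this is empty at every \<open>x\<close> with \<open>r x = \<infinity>\<close>.\<close>

definition subdiff :: "'a::real_inner set \<Rightarrow> ('a \<Rightarrow> ereal) \<Rightarrow> 'a \<Rightarrow> 'a set" where
  "subdiff E r x = {g \<in> E. \<forall>y\<in>E. r x + ereal (g \<bullet> (y - x)) \<le> r y}"

definition prox :: "'a::real_inner set \<Rightarrow> real \<Rightarrow> ('a \<Rightarrow> ereal) \<Rightarrow> 'a \<Rightarrow> 'a" where
  "prox E \<alpha> r x = arg_min_on (\<lambda>y. ereal \<alpha> * r y + ereal (1 / 2 * (norm (y - x))\<^sup>2)) E"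


section \<open>Stacked vectors and cyclic orders\<close>

text \<open>
  A stacked vector in \<open>R^(nd)\<close> is given by its blocks \<open>z 1, \<dots>, z n\<close>; values of \<open>z\<close> at other indices
  are irrelevant.
\<close>

definition stacked_norm :: "nat \<Rightarrow> (nat \<Rightarrow> 'a::real_normed_vector) \<Rightarrow> real" where
  "stacked_norm n z = sqrt (\<Sum>i=1..n. (norm (z i))\<^sup>2)"

definition order_norm :: "nat \<Rightarrow> (nat \<Rightarrow> nat) \<Rightarrow> (nat \<Rightarrow> 'a::real_normed_vector) \<Rightarrow> real" where
  "order_norm n \<pi> z = sqrt (\<Sum>i=1..n. real i / real n * (norm (z (\<pi> i)))\<^sup>2)"

definition optimal_order :: "nat \<Rightarrow> (nat \<Rightarrow> 'a::real_normed_vector) \<Rightarrow> (nat \<Rightarrow> nat) \<Rightarrow> bool" where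
  "optimal_order n z \<pi> \<longleftrightarrow>
    is_arg_min (\<lambda>\<sigma>. (order_norm n \<sigma> z)\<^sup>2) (\<lambda>\<sigma>. \<sigma> permutes {1..n}) \<pi>"

definition cyclic_sampling :: "nat \<Rightarrow> (nat \<Rightarrow> nat) \<Rightarrow> (nat \<Rightarrow> nat) \<Rightarrow> bool" where
  "cyclic_sampling n \<pi> idx \<longleftrightarrow> (\<forall>k. \<forall>j\<in>{1..n}. idx (k * n + j) = \<pi> j)"


section \<open>The algorithm\<close>

definition avg_fun :: "nat \<Rightarrow> (nat \<Rightarrow> 'a \<Rightarrow> real) \<Rightarrow> 'a \<Rightarrow> real" where
  "avg_fun n f x = (1 / real n) * (\<Sum>i=1..n. f i x)"

definition z_star ::
  "'a::real_inner set \<Rightarrow> real \<Rightarrow> (nat \<Rightarrow> 'a \<Rightarrow> real) \<Rightarrow> 'a \<Rightarrow> nat \<Rightarrow> 'a" where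
  "z_star E \<alpha> f x\<^sub>0 i = x\<^sub>0 - \<alpha> *\<^sub>R grad E (f i) x\<^sub>0"

text \<open>One inner iteration with sampled index \<open>i\<close>; the state is the pair of \<open>z\<close> and its running mean.\<close>

definition inner_step ::
  "'a::real_inner set \<Rightarrow> nat \<Rightarrow> real \<Rightarrow> (nat \<Rightarrow> 'a \<Rightarrow> real) \<Rightarrow> ('a \<Rightarrow> ereal) \<Rightarrow> nat
    \<Rightarrow> (nat \<Rightarrow> 'a) \<times> 'a \<Rightarrow> (nat \<Rightarrow> 'a) \<times> 'a" where
  "inner_step E n \<alpha> f r i = (\<lambda>(z, zbar).
    let x = prox E \<alpha> r zbar;
        w = x - \<alpha> *\<^sub>R grad E (f i) x
    in (z(i := w), zbar + (1 / real n) *\<^sub>R (w - z i)))"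

text \<open>The state at time \<open>k * n\<close>, that is, after \<open>k\<close> epochs and with damping applied.\<close>

primrec epoch_state ::
  "'a::real_inner set \<Rightarrow> nat \<Rightarrow> real \<Rightarrow> real \<Rightarrow> (nat \<Rightarrow> 'a \<Rightarrow> real) \<Rightarrow> ('a \<Rightarrow> ereal)
    \<Rightarrow> (nat \<Rightarrow> nat) \<Rightarrow> (nat \<Rightarrow> 'a) \<Rightarrow> nat \<Rightarrow> (nat \<Rightarrow> 'a) \<times> 'a" where
  "epoch_state E n \<alpha> \<theta> f r idx z\<^sub>0 0 = (z\<^sub>0, (1 / real n) *\<^sub>R (\<Sum>i=1..n. z\<^sub>0 i))"
| "epoch_state E n \<alpha> \<theta> f r idx z\<^sub>0 (Suc k) =
    (let (z, zbar) = epoch_state E n \<alpha> \<theta> f r idx z\<^sub>0 k;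
         (z', zbar') = fold (\<lambda>t. inner_step E n \<alpha> f r (idx t)) [k * n + 1..<(k + 1) * n + 1] (z, zbar)
     in (\<lambda>i. (1 - \<theta>) *\<^sub>R z i + \<theta> *\<^sub>R z' i, (1 - \<theta>) *\<^sub>R zbar + \<theta> *\<^sub>R zbar'))"

definition epoch_iterate ::
  "'a::real_inner set \<Rightarrow> nat \<Rightarrow> real \<Rightarrow> real \<Rightarrow> (nat \<Rightarrow> 'a \<Rightarrow> real) \<Rightarrow> ('a \<Rightarrow> ereal)
    \<Rightarrow> (nat \<Rightarrow> nat) \<Rightarrow> (nat \<Rightarrow> 'a) \<Rightarrow> nat \<Rightarrow> 'a" where
  "epoch_iterate E n \<alpha> \<theta> f r idx z\<^sub>0 k = prox E \<alpha> r (snd (epoch_state E n \<alpha> \<theta> f r idx z\<^sub>0 k))"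

end

theory Submission
  imports Defs
begin

text \<open>
  Let \<open>S i u = prox(u) - \<alpha> grad (f i) (prox(u))\<close>. For \<open>\<alpha> \<le> 2/L\<close> each \<open>S i\<close> is nonexpansive, and one undamped
  epoch is a Gauss-Seidel sweep \<open>a \<mapsto> b\<close> in which \<open>b j\<close> is \<open>S\<close> applied to the mean of
  \<open>b 1, \<dots>, b (j - 1), a j, \<dots>, a n\<close> (indices along the cyclic order). Weighting block \<open>j\<close> by \<open>j/n\<close>
  makes the sweep quasi-nonexpansive towards \<open>z\<^sup>*\<close>, so with damping the squared order-specific norms of
  \<open>b - a\<close> are summable over the epochs with sum at most
  \<open>\<parallel>z\<^sup>0 - z\<^sup>*\<parallel>\<^sup>2 / (\<theta>(1 - \<theta>)) \<le> c\<^sub>1c\<^sub>2 / (\<theta>(1 - \<theta>))\<close>. By Cauchy-Schwarz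
  with the weights \<open>j\<close>, whose inverses sum to at most \<open>ln n + 1\<close>, the squared residual at an epoch is at
  most \<open>4(ln n + 1) / (\<alpha>\<^sup>2n)\<close> times the squared order-specific norm of \<open>b - a\<close>. The best of the first
  \<open>\<lfloor>C(ln n + 1)L\<^sup>2/(n\<epsilon>)\<rfloor> + 1\<close> epochs is therefore good enough.
\<close>

section \<open>Gradients on a subspace\<close>

lemma subspace_line:
  assumes "subspace E" "x \<in> E" "y \<in> E"
  shows "x + t *\<^sub>R (y - x) \<in> E"
  using assms by (simp add: subspace_add subspace_diff subspace_scale)

text \<open>Reduces the analysis within \<open>E\<close> to calculus in one real variable: the chain
  rule is applied within the range of the line, which stays inside \<open>E\<close>.\<close>

lemma DERIV_along_line:
  fixes f :: "'a::real_inner \<Rightarrow> real"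
  assumes E: "subspace E" "x \<in> E" "h \<in> E"
    and f: "(f has_derivative (\<lambda>v. g \<bullet> v)) (at (x + t *\<^sub>R h) within E)"
  shows "((\<lambda>s. f (x + s *\<^sub>R h)) has_real_derivative g \<bullet> h) (at t)"
proof -
  have line: "((\<lambda>s::real. x + s *\<^sub>R h) has_derivative (\<lambda>s. s *\<^sub>R h)) (at t)"
    by (auto intro!: derivative_eq_intros)
  have "(f has_derivative (\<lambda>v. g \<bullet> v)) (at (x + t *\<^sub>R h) within range (\<lambda>s. x + s *\<^sub>R h))"
    using f by (rule has_derivative_subset) (auto simp: E subspace_add subspace_scale)
  from has_derivative_in_compose[OF line this]
  show ?thesis
    by (simp add: has_field_derivative_def mult.commute[of _ "g \<bullet> h"])
qed

lemma tendsto_directional_quotient: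
  fixes f :: "'a::real_inner \<Rightarrow> real"
  assumes E: "subspace E" "x \<in> E" "h \<in> E"
    and f: "(f has_derivative (\<lambda>v. g \<bullet> v)) (at x within E)"
  shows "((\<lambda>t. (f (x + t *\<^sub>R h) - f x) / t) \<longlongrightarrow> g \<bullet> h) (at_right 0)"
proof -
  have "((\<lambda>s. f (x + s *\<^sub>R h)) has_real_derivative g \<bullet> h) (at 0)"
    using f by (intro DERIV_along_line[OF E]) simp
  then have "((\<lambda>s. f (x + s *\<^sub>R h)) has_real_derivative g \<bullet> h) (at_right 0)"
    by (rule has_field_derivative_at_within)
  then show ?thesis
    by (simp add: has_field_derivative_iff)
qed

lemma eventually_at_right_0_le_1: "eventually (\<lambda>t::real. 0 < t \<and> t \<le> 1) (at_right 0)"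
  unfolding eventually_at_right_field by (rule exI[of _ 1]) auto

text \<open>Convexity bounds each difference quotient on the segment from \<open>x\<close> to
  \<open>y\<close> by \<open>f y - f x\<close>; the bound survives the limit t -> 0+.\<close>

lemma convex_above_tangent:
  fixes f :: "'a::real_inner \<Rightarrow> real"
  assumes E: "subspace E" "x \<in> E" "y \<in> E" and f: "convex_on E f"
    and g: "(f has_derivative (\<lambda>v. g \<bullet> v)) (at x within E)"
  shows "f x + g \<bullet> (y - x) \<le> f y"
proof -
  have "g \<bullet> (y - x) \<le> f y - f x"
  proof (rule tendsto_upperbound)
    show "((\<lambda>t. (f (x + t *\<^sub>R (y - x)) - f x) / t) \<longlongrightarrow> g \<bullet> (y - x)) (at_right 0)"
      using E g by (intro tendsto_directional_quotient) (auto simp: subspace_diff)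
    show "\<forall>\<^sub>F t in at_right 0. (f (x + t *\<^sub>R (y - x)) - f x) / t \<le> f y - f x"
    proof (rule eventually_mono[OF eventually_at_right_0_le_1])
      fix t :: real assume t: "0 < t \<and> t \<le> 1"
      have "f (x + t *\<^sub>R (y - x)) = f ((1 - t) *\<^sub>R x + t *\<^sub>R y)"
        by (simp add: algebra_simps)
      also have "\<dots> \<le> (1 - t) * f x + t * f y"
        using t by (intro convex_onD[OF f]) (auto simp: E)
      finally show "(f (x + t *\<^sub>R (y - x)) - f x) / t \<le> f y - f x"
        using t by (simp add: field_simps)
    qed
  qed simp
  then show ?thesis by simp
qed

text \<open>Along the segment, \<open>f\<close> minus its quadratic upper model has nonpositive
  derivative on [0, 1], so comparing the two endpoints gives the bound.\<close>

lemma lipschitz_gradient_upper_bound: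
  fixes f :: "'a::real_inner \<Rightarrow> real"
  assumes E: "subspace E" "x \<in> E" "y \<in> E"
    and g: "\<And>x. x \<in> E \<Longrightarrow> (f has_derivative (\<lambda>v. G x \<bullet> v)) (at x within E)"
    and L: "L-lipschitz_on E G"
  shows "f y \<le> f x + G x \<bullet> (y - x) + L / 2 * (norm (y - x))\<^sup>2"
proof -
  define h where "h = y - x"
  define \<phi> where "\<phi> t = f (x + t *\<^sub>R h) - t * (G x \<bullet> h) - L / 2 * t\<^sup>2 * (norm h)\<^sup>2" for t
  have hE: "h \<in> E" using E by (simp add: h_def subspace_diff)
  have lE: "x + t *\<^sub>R h \<in> E" for t using E hE by (simp add: subspace_add subspace_scale)
  have "\<phi> 1 \<le> \<phi> 0"
  proof (rule DERIV_nonpos_imp_nonincreasing[of 0 1 \<phi>])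
    fix t :: real assume t: "0 \<le> t" "t \<le> 1"
    have "(\<phi> has_real_derivative G (x + t *\<^sub>R h) \<bullet> h - G x \<bullet> h - L * t * (norm h)\<^sup>2) (at t)"
      unfolding \<phi>_def
      by (auto intro!: derivative_eq_intros DERIV_along_line[OF E(1,2) hE g[OF lE]])
    moreover have "(G (x + t *\<^sub>R h) - G x) \<bullet> h \<le> L * t * (norm h)\<^sup>2"
    proof -
      have "(G (x + t *\<^sub>R h) - G x) \<bullet> h \<le> norm (G (x + t *\<^sub>R h) - G x) * norm h"
        by (rule norm_cauchy_schwarz)
      also have "\<dots> \<le> (L * (t * norm h)) * norm h"
        using lipschitz_onD[OF L lE E(2), of t] t
        by (intro mult_right_mono) (simp_all add: dist_norm)
      finally show ?thesis by (simp add: power2_eq_square mult_ac)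
    qed
    ultimately show "\<exists>y. (\<phi> has_real_derivative y) (at t) \<and> y \<le> 0"
      by (auto simp: inner_diff_left)
  qed simp
  then show ?thesis by (simp add: \<phi>_def h_def)
qed

text \<open>The point \<open>w\<close> minimizes, over a quadratic model around \<open>y\<close>,
  the upper bound for \<open>f\<close> minus its linear part at \<open>x\<close>. The tangent at
  \<open>x\<close> bounds \<open>f w\<close> from below and the quadratic model bounds it from
  above.\<close>

lemma gradient_cocoercive_half:
  fixes f :: "'a::real_inner \<Rightarrow> real"
  assumes E: "subspace E" "x \<in> E" "y \<in> E" and f: "convex_on E f"
    and GE: "\<And>x. x \<in> E \<Longrightarrow> G x \<in> E"
    and g: "\<And>x. x \<in> E \<Longrightarrow> (f has_derivative (\<lambda>v. G x \<bullet> v)) (at x within E)"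
    and L: "L-lipschitz_on E G" "L > 0"
  shows "f x + G x \<bullet> (y - x) + 1 / (2 * L) * (norm (G y - G x))\<^sup>2 \<le> f y"
proof -
  define D where "D = G y - G x"
  define w where "w = y - (1 / L) *\<^sub>R D"
  have w: "w \<in> E"
    using E GE by (simp add: w_def D_def subspace_diff subspace_scale)
  have "f x + G x \<bullet> (w - x) \<le> f w"
    using E w f g by (intro convex_above_tangent) auto
  also have "f w \<le> f y + G y \<bullet> (w - y) + L / 2 * (norm (w - y))\<^sup>2"
    using E w g L by (intro lipschitz_gradient_upper_bound) auto
  finally have "f x + G x \<bullet> (y - x) - (1 / L) * (G x \<bullet> D)
      \<le> f y - (1 / L) * (G y \<bullet> D) + L / 2 * (1 / L)\<^sup>2 * (norm D)\<^sup>2"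
    using L by (simp add: w_def inner_diff_right power_mult_distrib power_divide)
  moreover have "(1 / L) * (G y \<bullet> D) - (1 / L) * (G x \<bullet> D) = (1 / L) * (norm D)\<^sup>2"
    by (simp add: D_def power2_norm_eq_inner inner_diff_left right_diff_distrib)
  moreover have "L / 2 * (1 / L)\<^sup>2 * (norm D)\<^sup>2 = 1 / (2 * L) * (norm D)\<^sup>2"
      "(1 / L) * (norm D)\<^sup>2 = 2 * (1 / (2 * L) * (norm D)\<^sup>2)"
    using L by (simp_all add: power2_eq_square)
  ultimately show ?thesis by (simp only: D_def)
qed

text \<open>Adding the previous inequality to its mirror image gives cocoercivity of
  \<open>G\<close>. For \<open>\<alpha> \<le> 2 / L\<close> the cross term of the expanded square
  then absorbs the quadratic one.\<close>

lemma gradient_step_nonexpansive: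
  fixes f :: "'a::real_inner \<Rightarrow> real"
  assumes E: "subspace E" "x \<in> E" "y \<in> E" and f: "convex_on E f"
    and GE: "\<And>x. x \<in> E \<Longrightarrow> G x \<in> E"
    and g: "\<And>x. x \<in> E \<Longrightarrow> (f has_derivative (\<lambda>v. G x \<bullet> v)) (at x within E)"
    and L: "L-lipschitz_on E G" "L > 0" and \<alpha>: "0 < \<alpha>" "\<alpha> \<le> 2 / L"
  shows "norm ((x - \<alpha> *\<^sub>R G x) - (y - \<alpha> *\<^sub>R G y)) \<le> norm (x - y)"
proof -
  define D where "D = G x - G y"
  have "f x + G x \<bullet> (y - x) + 1 / (2 * L) * (norm D)\<^sup>2 \<le> f y"
    "f y + G y \<bullet> (x - y) + 1 / (2 * L) * (norm D)\<^sup>2 \<le> f x"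
    using gradient_cocoercive_half[OF E f GE g L] gradient_cocoercive_half[OF E(1,3,2) f GE g L]
    by (auto simp: D_def norm_minus_commute)
  then have coc: "1 / L * (norm D)\<^sup>2 \<le> D \<bullet> (x - y)"
    by (simp add: D_def inner_diff_left inner_diff_right)
  have "(norm ((x - y) - \<alpha> *\<^sub>R D))\<^sup>2 = (norm (x - y))\<^sup>2 - \<alpha> * (2 * (D \<bullet> (x - y)) - \<alpha> * (norm D)\<^sup>2)"
    by (simp add: power2_norm_eq_inner inner_diff_left inner_diff_right inner_commute algebra_simps)
  moreover have "\<alpha> * (norm D)\<^sup>2 \<le> 2 * (D \<bullet> (x - y))"
    using mult_right_mono[OF \<alpha>(2), of "(norm D)\<^sup>2"] coc by simp
  ultimately have "(norm ((x - y) - \<alpha> *\<^sub>R D))\<^sup>2 \<le> (norm (x - y))\<^sup>2"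
    using \<alpha>(1) by simp
  then have "norm ((x - y) - \<alpha> *\<^sub>R D) \<le> norm (x - y)"
    by (rule power2_le_imp_le) simp
  then show ?thesis
    by (simp add: D_def algebra_simps)
qed

section \<open>Uniqueness and existence of gradients on R^d\<close>

lemma has_gradient_unique:
  fixes f :: "'a::real_inner \<Rightarrow> real"
  assumes E: "subspace E" "x \<in> E" "g \<in> E" "g' \<in> E"
    and "(f has_derivative (\<lambda>h. g \<bullet> h)) (at x within E)"
    and "(f has_derivative (\<lambda>h. g' \<bullet> h)) (at x within E)"
  shows "g = g'"
proof -
  have D: "((\<lambda>s. f (x + s *\<^sub>R (g - g'))) has_real_derivative u \<bullet> (g - g')) (at 0)"
    if "(f has_derivative (\<lambda>h. u \<bullet> h)) (at x within E)" for u
    using E that by (intro DERIV_along_line[of E]) (auto simp: subspace_diff)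
  have "g \<bullet> (g - g') = g' \<bullet> (g - g')"
    using DERIV_unique[OF D D] assms by blast
  then have "(g - g') \<bullet> (g - g') = 0"
    by (simp add: inner_diff_left)
  then show ?thesis by simp
qed

lemma grad_eqI:
  assumes "subspace E" "x \<in> E" "g \<in> E" "(f has_derivative (\<lambda>h. g \<bullet> h)) (at x within E)"
  shows "grad E f x = g"
  unfolding grad_def using assms by (blast intro: has_gradient_unique)

text \<open>The ambient sequence space is not complete, so the representing vector is built by hand:
  its coordinates are the values of \<open>D\<close> on the unit vectors of R^d.\<close>

lemma Riesz_Rn:
  assumes "bounded_linear D"
  obtains g where "g \<in> Rn d" and "\<And>h. h \<in> Rn d \<Longrightarrow> D h = g \<bullet> h"
proof -
  interpret D: bounded_linear D by fact
  have "\<forall>j. \<exists>e. e \<in> Rn d \<and> (\<forall>i<d. coord e i = (if i = j then 1 else 0))"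
  proof
    fix j
    show "\<exists>e. e \<in> Rn d \<and> (\<forall>i<d. coord e i = (if i = j then 1 else 0))"
      using ex1_Rn[of d "\<lambda>i. if i = j then 1 else 0"] by (rule ex1_implies_ex)
  qed
  then obtain e where e: "\<And>j. e j \<in> Rn d" "\<And>i j. i < d \<Longrightarrow> coord (e j) i = (if i = j then 1 else 0)"
    by metis
  obtain g where g: "g \<in> Rn d" "\<And>i. i < d \<Longrightarrow> coord g i = D (e i)"
    using ex1_Rn[of d "\<lambda>i. D (e i)"] by blast
  have "D h = g \<bullet> h" if h: "h \<in> Rn d" for h
  proof -
    have s: "(\<Sum>i<d. coord h i *\<^sub>R e i) \<in> Rn d"
      by (intro subspace_sum subspace_scale subspace_Rn e)
    have c: "coord (\<Sum>i\<in>A. coord h i *\<^sub>R e i) j = (\<Sum>i\<in>A. coord h i * coord (e i) j)" for A j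
      by (induction A rule: infinite_finite_induct) auto
    have "coord (\<Sum>i<d. coord h i *\<^sub>R e i) j = coord h j" for j
    proof (cases "j < d")
      case True
      then show ?thesis by (simp add: c e sum.delta if_distrib cong: if_cong)
    next
      case False
      then show ?thesis using s h by (simp add: Rn_def)
    qed
    then have "h = (\<Sum>i<d. coord h i *\<^sub>R e i)"
      by (simp add: fseq_eq_iff)
    then have "D h = D (\<Sum>i<d. coord h i *\<^sub>R e i)"
      by (rule arg_cong)
    also have "\<dots> = (\<Sum>i<d. coord h i * D (e i))"
      by (simp add: D.sum D.scaleR)
    also have "\<dots> = g \<bullet> h"
      using g by (simp add: inner_Rn mult.commute)
    finally show ?thesis .
  qed
  with g that show thesis by blast
qed

text \<open>Shows that the definite description behind \<open>grad\<close> is meaningful. A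
  derivative within R^d only sees increments in R^d, so it may be replaced there by its representing
  inner product.\<close>

lemma grad_Rn:
  assumes "f differentiable_on Rn d" "x \<in> Rn d"
  shows "grad (Rn d) f x \<in> Rn d"
    and "(f has_derivative (\<lambda>h. grad (Rn d) f x \<bullet> h)) (at x within Rn d)"
proof -
  obtain D where D: "(f has_derivative D) (at x within Rn d)"
    using assms by (auto simp: differentiable_on_def differentiable_def)
  obtain g where g: "g \<in> Rn d" "\<And>h. h \<in> Rn d \<Longrightarrow> D h = g \<bullet> h"
    using Riesz_Rn[OF has_derivative_bounded_linear[OF D]] by blast
  have "(f has_derivative (\<lambda>h. g \<bullet> h)) (at x within Rn d)"
    unfolding has_derivative_within
  proof
    show "bounded_linear (\<lambda>h. g \<bullet> h)" by (rule bounded_linear_inner_right)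
    have "((\<lambda>y. (1 / norm (y - x)) *\<^sub>R (f y - (f x + D (y - x)))) \<longlongrightarrow> 0) (at x within Rn d)"
      using D by (simp add: has_derivative_within)
    then show "((\<lambda>y. (1 / norm (y - x)) *\<^sub>R (f y - (f x + g \<bullet> (y - x)))) \<longlongrightarrow> 0) (at x within Rn d)"
      by (rule Lim_transform_eventually)
        (auto simp: eventually_at_filter g subspace_diff[OF subspace_Rn _ assms(2)])
  qed
  moreover from grad_eqI[OF subspace_Rn assms(2) g(1) this] have "grad (Rn d) f x = g" .
  ultimately show "grad (Rn d) f x \<in> Rn d"
    and "(f has_derivative (\<lambda>h. grad (Rn d) f x \<bullet> h)) (at x within Rn d)"
    using g(1) by simp_all
qed

lemma has_derivative_avg_fun:
  fixes f :: "nat \<Rightarrow> 'a::real_inner \<Rightarrow> real"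
  assumes "\<And>i. i \<in> {1..n} \<Longrightarrow> (f i has_derivative (\<lambda>h. g i \<bullet> h)) (at x within E)"
  shows "(avg_fun n f has_derivative (\<lambda>h. ((1 / real n) *\<^sub>R (\<Sum>i=1..n. g i)) \<bullet> h)) (at x within E)"
proof -
  have "(avg_fun n f has_derivative (\<lambda>h. (1 / real n) * (\<Sum>i=1..n. g i \<bullet> h))) (at x within E)"
    unfolding avg_fun_def[abs_def]
    by (intro has_derivative_mult_right has_derivative_sum assms)
  then show ?thesis by (simp add: inner_sum_left)
qed

section \<open>Proximal maps and subdifferentials\<close>

text \<open>Completeness holds only for the subspaces. Coordinates of a Cauchy sequence converge,
  and on R^d the norm is a continuous function of finitely many of them.\<close>

lemma complete_Rn: "complete (Rn d)"
  unfolding complete_def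
proof (intro allI impI, elim conjE)
  fix X assume X: "\<forall>n. X n \<in> Rn d" and C: "Cauchy X"
  have le: "\<bar>coord x i\<bar> \<le> norm x" for x i
  proof (cases "coord x i = 0")
    case False
    have "(coord x i)\<^sup>2 \<le> x \<bullet> x"
      using False unfolding inner_fseq_def power2_eq_square
      by (intro member_le_sum) auto
    then show ?thesis
      by (simp add: norm_eq_sqrt_inner real_le_rsqrt)
  qed simp
  have "Cauchy (\<lambda>k. coord (X k) i)" for i
  proof (rule metric_CauchyI)
    fix e :: real assume "e > 0"
    then obtain M where "\<And>m n. m \<ge> M \<Longrightarrow> n \<ge> M \<Longrightarrow> dist (X m) (X n) < e"
      using metric_CauchyD[OF C] by blast
    moreover have "dist (coord (X m) i) (coord (X n) i) \<le> dist (X m) (X n)" for m n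
      using le[of "X m - X n" i] by (simp add: dist_norm)
    ultimately show "\<exists>M. \<forall>m\<ge>M. \<forall>n\<ge>M. dist (coord (X m) i) (coord (X n) i) < e"
      by (meson le_less_trans)
  qed
  then have "\<forall>i. \<exists>l. (\<lambda>k. coord (X k) i) \<longlonglongrightarrow> l"
    by (simp add: Cauchy_convergent_iff convergent_def)
  then obtain l where l: "\<And>i. (\<lambda>k. coord (X k) i) \<longlonglongrightarrow> l i"
    by metis
  obtain x where x: "x \<in> Rn d" "\<And>i. i < d \<Longrightarrow> coord x i = l i"
    using ex1_Rn[of d l] by blast
  have "norm (X k - x) = sqrt (\<Sum>i<d. (coord (X k) i - l i) * (coord (X k) i - l i))" for k
    using X x subspace_diff[OF subspace_Rn, of "X k" d x]
    by (simp add: norm_eq_sqrt_inner inner_Rn[of "X k - x" d])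
  moreover have "(\<lambda>k. sqrt (\<Sum>i<d. (coord (X k) i - l i) * (coord (X k) i - l i)))
      \<longlonglongrightarrow> sqrt (\<Sum>i<d. (l i - l i) * (l i - l i))"
    by (intro tendsto_intros l)
  ultimately have "(\<lambda>k. norm (X k - x)) \<longlonglongrightarrow> 0" by simp
  then have "X \<longlonglongrightarrow> x"
    by (rule LIM_zero_cancel[OF tendsto_norm_zero_cancel])
  then show "\<exists>x\<in>Rn d. X \<longlonglongrightarrow> x" using x by blast
qed

lemma norm_add_scaleR_squared:
  fixes x y :: "'a::real_inner"
  shows "(norm (x + t *\<^sub>R y))\<^sup>2 = (norm x)\<^sup>2 + 2 * t * (y \<bullet> x) + t\<^sup>2 * (norm y)\<^sup>2"
  unfolding power2_norm_eq_inner inner_add_left inner_add_right inner_scaleR_left inner_scaleR_right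
    inner_commute[of x y]
  by algebra

text \<open>
  A minimizing sequence in the epigraph is Cauchy by the parallelogram law, so completeness of
  \<open>E\<close> replaces compactness.
\<close>

lemma ex_arg_min_proximal:
  fixes h :: "'a::real_inner \<Rightarrow> ereal"
  assumes E: "subspace E" "complete E"
    and h: "convex_ext E h" "closed_ext E h" "proper_ext E h"
    and minorant: "\<And>y. y \<in> E \<Longrightarrow> ereal (b + c \<bullet> y) \<le> h y"
    and \<alpha>: "\<alpha> > 0"
  shows "\<exists>p. is_arg_min (\<lambda>y. ereal \<alpha> * h y + ereal (1 / 2 * (norm (y - u))\<^sup>2)) (\<lambda>y. y \<in> E) p"
proof -
  define epi where "epi = {(y, t :: real). y \<in> E \<and> h y \<le> ereal t}"
  define v where "v = (\<lambda>(y, t). \<alpha> * t + 1 / 2 * (norm (y - u))\<^sup>2)"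
  obtain y0 where y0: "y0 \<in> E" "h y0 \<noteq> \<infinity>" "h y0 \<noteq> -\<infinity>"
    using h(3) by (auto simp: proper_ext_def)
  then obtain t0 where "h y0 = ereal t0" by (cases "h y0") auto
  with y0 have "(y0, t0) \<in> epi" by (simp add: epi_def)
  then have ne: "v ` epi \<noteq> {}" by blast
  \<comment> \<open>Completing the square: the left side is the minimum of the affine minorant times
    \<open>\<alpha>\<close> plus the quadratic term, attained at
    \<open>u - \<alpha> *\<^sub>R c\<close>.\<close>
  have "\<alpha> * b + \<alpha> * (c \<bullet> u) - \<alpha>\<^sup>2 / 2 * (norm c)\<^sup>2 \<le> v q" if "q \<in> epi" for q
  proof -
    obtain y t where q: "q = (y, t)" by (cases q)
    with that have "y \<in> E" "h y \<le> ereal t" by (auto simp: epi_def)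
    then have "ereal (b + c \<bullet> y) \<le> ereal t"
      using minorant order_trans by blast
    then have "\<alpha> * (b + c \<bullet> y) \<le> \<alpha> * t" using \<alpha> by simp
    moreover have "0 \<le> (norm (y - u + \<alpha> *\<^sub>R c))\<^sup>2" by simp
    ultimately show ?thesis
      unfolding norm_add_scaleR_squared by (simp add: q v_def inner_diff_right algebra_simps)
  qed
  then have bdd: "bdd_below (v ` epi)" by (intro bdd_belowI2)
  define m where "m = Inf (v ` epi)"
  have m: "m \<le> v q" if "q \<in> epi" for q
    unfolding m_def using that bdd by (intro cInf_lower) auto
  have "\<exists>q\<in>epi. v q < m + 1 / real (Suc k)" for k
  proof -
    have "Inf (v ` epi) < m + 1 / real (Suc k)" by (simp add: m_def)
    then show ?thesis using cInf_lessD[OF ne] by blast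
  qed
  then obtain q where q: "\<And>k. q k \<in> epi" "\<And>k. v (q k) < m + 1 / real (Suc k)"
    by metis
  define Y T where "Y k = fst (q k)" and "T k = snd (q k)" for k
  have YT: "q k = (Y k, T k)" for k by (simp add: Y_def T_def)
  have YE: "Y k \<in> E" for k using q(1)[of k] by (simp add: epi_def YT)
  have para: "(norm (Y j - Y k))\<^sup>2 \<le> 4 * (v (q j) + v (q k) - 2 * m)" for j k
  proof -
    have "h ((1/2) *\<^sub>R Y j + (1/2) *\<^sub>R Y k) \<le> ereal (1/2) * h (Y j) + ereal (1/2) * h (Y k)"
      using h(1) YE unfolding convex_ext_def by (metis field_sum_of_halves half_gt_zero_iff less_le zero_less_one)
    also have "\<dots> \<le> ereal (1/2) * ereal (T j) + ereal (1/2) * ereal (T k)"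
      using q(1)[of j] q(1)[of k] unfolding YT epi_def
      by (intro add_mono ereal_mult_left_mono) auto
    finally have "((1/2) *\<^sub>R Y j + (1/2) *\<^sub>R Y k, 1/2 * T j + 1/2 * T k) \<in> epi"
      using YE E(1) by (simp add: epi_def subspace_add subspace_scale)
    from m[OF this] have "m \<le> 1/2 * v (q j) + 1/2 * v (q k) - 1/8 * (norm (Y j - Y k))\<^sup>2"
      by (simp add: YT v_def power2_norm_eq_inner inner_add_left inner_add_right
          inner_diff_left inner_diff_right inner_commute add_divide_distrib algebra_simps)
    then show ?thesis by simp
  qed
  have "Cauchy Y"
  proof (rule metric_CauchyI)
    fix e :: real assume e: "e > 0"
    \<comment> \<open>With both values within 1/(N+1) of \<open>m\<close>, the bound
      \<open>para\<close> gives at most 8/(N+1), hence the 8.\<close>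
    obtain N where N: "1 / real (Suc N) < e\<^sup>2 / 8"
      using e nat_approx_posE[of "e\<^sup>2 / 8"] by auto
    have "dist (Y j) (Y k) < e" if "j \<ge> N" "k \<ge> N" for j k
    proof -
      have "1 / real (Suc j) \<le> 1 / real (Suc N)" "1 / real (Suc k) \<le> 1 / real (Suc N)"
        using that by (auto intro!: divide_left_mono)
      then have "(norm (Y j - Y k))\<^sup>2 < e\<^sup>2"
        using para[of j k] q(2)[of j] q(2)[of k] N by simp
      then show ?thesis
        using e by (simp add: dist_norm power2_less_imp_less)
    qed
    then show "\<exists>M. \<forall>j\<ge>M. \<forall>k\<ge>M. dist (Y j) (Y k) < e" by blast
  qed
  then obtain p where p: "p \<in> E" "Y \<longlonglongrightarrow> p"
    using E(2) YE unfolding complete_def by blast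
  have vlim: "(\<lambda>k. v (q k)) \<longlonglongrightarrow> m"
  proof (rule tendsto_sandwich)
    show "\<forall>\<^sub>F k in sequentially. m \<le> v (q k)" using m q(1) by simp
    show "\<forall>\<^sub>F k in sequentially. v (q k) \<le> m + 1 / real (Suc k)"
      using q(2) by (simp add: less_imp_le)
    show "(\<lambda>k. m + 1 / real (Suc k)) \<longlonglongrightarrow> m"
      using tendsto_add[OF tendsto_const LIMSEQ_inverse_real_of_nat, of m]
      by (simp add: inverse_eq_divide)
  qed simp
  \<comment> \<open>The heights are determined by objective values and points, so they converge as
    well and closedness of the epigraph applies to the pairs.\<close>
  have T_eq: "T k = (v (q k) - 1 / 2 * (norm (Y k - u))\<^sup>2) / \<alpha>" for k
    using \<alpha> by (simp add: YT v_def)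
  have "T \<longlonglongrightarrow> (m - 1 / 2 * (norm (p - u))\<^sup>2) / \<alpha>"
    unfolding T_eq[abs_def] using \<alpha> by (intro tendsto_intros vlim p) auto
  then have lim: "(\<lambda>k. (Y k, T k)) \<longlonglongrightarrow> (p, (m - 1 / 2 * (norm (p - u))\<^sup>2) / \<alpha>)"
    by (intro tendsto_Pair p)
  have "closed epi" using h(2) by (simp add: closed_ext_def epi_def)
  moreover have "(Y k, T k) \<in> epi" for k using q(1)[of k] by (simp add: YT)
  ultimately have "(p, (m - 1 / 2 * (norm (p - u))\<^sup>2) / \<alpha>) \<in> epi"
    using lim by (rule closed_sequentially)
  then have "h p \<le> ereal ((m - 1 / 2 * (norm (p - u))\<^sup>2) / \<alpha>)"
    by (simp add: epi_def)
  then have "ereal \<alpha> * h p \<le> ereal \<alpha> * ereal ((m - 1 / 2 * (norm (p - u))\<^sup>2) / \<alpha>)"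
    using \<alpha> by (intro ereal_mult_left_mono) auto
  then have "ereal \<alpha> * h p + ereal (1 / 2 * (norm (p - u))\<^sup>2)
      \<le> ereal (m - 1 / 2 * (norm (p - u))\<^sup>2) + ereal (1 / 2 * (norm (p - u))\<^sup>2)"
    using \<alpha> by (intro add_right_mono) simp
  then have pm: "ereal \<alpha> * h p + ereal (1 / 2 * (norm (p - u))\<^sup>2) \<le> ereal m"
    by simp
  have "ereal m \<le> ereal \<alpha> * h y + ereal (1 / 2 * (norm (y - u))\<^sup>2)" if y: "y \<in> E" for y
  proof (cases "h y")
    case (real t)
    then have "(y, t) \<in> epi" using y by (simp add: epi_def)
    from m[OF this] show ?thesis by (simp add: real v_def)
  next
    case PInf
    then show ?thesis using \<alpha> by simp
  next
    case MInf
    then show ?thesis using h(3) y by (simp add: proper_ext_def)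
  qed
  with pm p(1) show ?thesis
    unfolding is_arg_min_def by (meson leD order_trans)
qed

text \<open>Fermat's rule for a convex \<open>r\<close> plus a differentiable \<open>G\<close>:
  compare \<open>p\<close> with points on the segment to \<open>y\<close>, use convexity of
  \<open>r\<close>, divide by t and let t -> 0+. It serves both the proximal objective and the
  minimizer of F + r.\<close>

lemma arg_min_subgradient:
  fixes r :: "'a::real_inner \<Rightarrow> ereal" and G :: "'a \<Rightarrow> real"
  assumes E: "subspace E" and r: "convex_ext E r" "proper_ext E r" and \<alpha>: "\<alpha> > 0"
    and p: "is_arg_min (\<lambda>y. ereal \<alpha> * r y + ereal (G y)) (\<lambda>y. y \<in> E) p"
    and g: "g \<in> E" "(G has_derivative (\<lambda>h. g \<bullet> h)) (at p within E)"
  shows "- ((1 / \<alpha>) *\<^sub>R g) \<in> subdiff E r p"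
proof -
  have pE: "p \<in> E" and min: "\<And>y. y \<in> E \<Longrightarrow> ereal \<alpha> * r p + ereal (G p) \<le> ereal \<alpha> * r y + ereal (G y)"
    using p by (auto simp: is_arg_min_def not_less)
  obtain y0 where y0: "y0 \<in> E" "r y0 \<noteq> \<infinity>" "r y0 \<noteq> -\<infinity>"
    using r(2) by (auto simp: proper_ext_def)
  then have "r p \<noteq> \<infinity>"
    using min[OF y0(1)] \<alpha> by (cases "r y0") auto
  then obtain a where a: "r p = ereal a"
    using r(2) pE by (cases "r p") (auto simp: proper_ext_def)
  have "r p + ereal (- ((1 / \<alpha>) *\<^sub>R g) \<bullet> (y - p)) \<le> r y" if y: "y \<in> E" for y
  proof (cases "r y")
    case (real b)
    have "\<alpha> * (a - b) \<le> g \<bullet> (y - p)"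
    proof (rule tendsto_lowerbound)
      show "((\<lambda>t. (G (p + t *\<^sub>R (y - p)) - G p) / t) \<longlongrightarrow> g \<bullet> (y - p)) (at_right 0)"
        using E pE y g by (intro tendsto_directional_quotient) (auto simp: subspace_diff)
      show "\<forall>\<^sub>F t in at_right 0. \<alpha> * (a - b) \<le> (G (p + t *\<^sub>R (y - p)) - G p) / t"
      proof (rule eventually_mono[OF eventually_at_right_0_le_1])
        fix t :: real assume t: "0 < t \<and> t \<le> 1"
        have w: "p + t *\<^sub>R (y - p) = (1 - t) *\<^sub>R p + t *\<^sub>R y" by (simp add: algebra_simps)
        have wE: "p + t *\<^sub>R (y - p) \<in> E" using E pE y by (rule subspace_line)
        have "r (p + t *\<^sub>R (y - p)) \<le> ereal (1 - t) * r p + ereal t * r y"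
          unfolding w using r(1) pE y t by (simp add: convex_ext_def)
        then have "r (p + t *\<^sub>R (y - p)) \<le> ereal ((1 - t) * a + t * b)"
          by (simp add: a real)
        then have "ereal \<alpha> * r (p + t *\<^sub>R (y - p)) \<le> ereal \<alpha> * ereal ((1 - t) * a + t * b)"
          using \<alpha> by (intro ereal_mult_left_mono) auto
        then have "ereal \<alpha> * r (p + t *\<^sub>R (y - p)) + ereal (G (p + t *\<^sub>R (y - p)))
            \<le> ereal \<alpha> * ereal ((1 - t) * a + t * b) + ereal (G (p + t *\<^sub>R (y - p)))"
          by (rule add_right_mono)
        with min[OF wE] have "ereal \<alpha> * r p + ereal (G p)
            \<le> ereal \<alpha> * ereal ((1 - t) * a + t * b) + ereal (G (p + t *\<^sub>R (y - p)))"
          by (rule order_trans)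
        then have "\<alpha> * (a - b) * t \<le> G (p + t *\<^sub>R (y - p)) - G p"
          by (simp add: a algebra_simps)
        then show "\<alpha> * (a - b) \<le> (G (p + t *\<^sub>R (y - p)) - G p) / t"
          using t by (simp add: pos_le_divide_eq)
      qed
    qed simp
    then show ?thesis using \<alpha> by (simp add: a real field_simps)
  next
    case MInf
    then show ?thesis using r(2) y by (simp add: proper_ext_def)
  qed simp
  with E g show ?thesis by (auto simp: subdiff_def subspace_neg subspace_scale)
qed

section \<open>Subgradients and the proximal map\<close>

lemma subdiff_finite:
  assumes "proper_ext E r" "g \<in> subdiff E r p" "p \<in> E"
  obtains a where "r p = ereal a"
proof -
  obtain y0 where "y0 \<in> E" "r y0 \<noteq> \<infinity>" using assms by (auto simp: proper_ext_def)
  with assms have "r p \<noteq> \<infinity>" by (cases "r y0") (auto simp: subdiff_def proper_ext_def)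
  with assms that show thesis by (cases "r p") (auto simp: proper_ext_def)
qed

text \<open>Nonexpansiveness of the proximal map, stated for its inverse \<open>p + \<alpha> \<partial>r(p)\<close>.\<close>

lemma resolvent_nonexpansive:
  fixes r :: "'a::real_inner \<Rightarrow> ereal"
  assumes r: "proper_ext E r" and p: "p \<in> E" "p' \<in> E"
    and g: "g \<in> subdiff E r p" "g' \<in> subdiff E r p'" and \<alpha>: "\<alpha> > 0"
  shows "norm (p - p') \<le> norm ((p + \<alpha> *\<^sub>R g) - (p' + \<alpha> *\<^sub>R g'))"
proof -
  obtain a a' where a: "r p = ereal a" "r p' = ereal a'"
    using subdiff_finite[OF r] p g by metis
  have "a + g \<bullet> (p' - p) \<le> a'" "a' + g' \<bullet> (p - p') \<le> a"
    using g p a by (auto simp: subdiff_def)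
  then have mono: "0 \<le> (g - g') \<bullet> (p - p')"
    by (simp add: inner_diff_left inner_diff_right)
  have "(norm ((p - p') + \<alpha> *\<^sub>R (g - g')))\<^sup>2
      = (norm (p - p'))\<^sup>2 + 2 * \<alpha> * ((g - g') \<bullet> (p - p')) + \<alpha>\<^sup>2 * (norm (g - g'))\<^sup>2"
    by (rule norm_add_scaleR_squared)
  then have "(norm (p - p'))\<^sup>2 \<le> (norm ((p - p') + \<alpha> *\<^sub>R (g - g')))\<^sup>2"
    using mono \<alpha> by simp
  then have "norm (p - p') \<le> norm ((p - p') + \<alpha> *\<^sub>R (g - g'))"
    by (rule power2_le_imp_le) simp
  then show ?thesis by (simp add: algebra_simps)
qed

text \<open>The given subgradient at \<open>x\<close> supplies the affine minorant that makes the
  proximal objective bounded below; the inclusion is then the optimality condition of its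
  minimizer.\<close>

lemma prox_subgradient:
  fixes r :: "'a::real_inner \<Rightarrow> ereal"
  assumes E: "subspace E" "complete E"
    and r: "convex_ext E r" "closed_ext E r" "proper_ext E r"
    and g: "g \<in> subdiff E r x" "x \<in> E" and \<alpha>: "\<alpha> > 0" and u: "u \<in> E"
  shows "prox E \<alpha> r u \<in> E" and "(1 / \<alpha>) *\<^sub>R (u - prox E \<alpha> r u) \<in> subdiff E r (prox E \<alpha> r u)"
proof -
  obtain a where a: "r x = ereal a" using subdiff_finite[OF r(3) g] .
  have "ereal ((a - g \<bullet> x) + g \<bullet> y) \<le> r y" if "y \<in> E" for y
    using g that a by (auto simp: subdiff_def inner_diff_right algebra_simps)
  from ex_arg_min_proximal[OF E r this \<alpha>]
  have p: "is_arg_min (\<lambda>y. ereal \<alpha> * r y + ereal (1 / 2 * (norm (y - u))\<^sup>2)) (\<lambda>y. y \<in> E) (prox E \<alpha> r u)"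
    unfolding prox_def arg_min_on_def arg_min_def by (rule someI_ex)
  then show pE: "prox E \<alpha> r u \<in> E" by (simp add: is_arg_min_def)
  have "((\<lambda>y. 1 / 2 * (norm (y - u))\<^sup>2) has_derivative (\<lambda>h. (q - u) \<bullet> h)) (at q within E)" for q
    unfolding power2_norm_eq_inner
    by (auto intro!: derivative_eq_intros simp: inner_commute)
  from arg_min_subgradient[OF E(1) r(1,3) \<alpha> p _ this]
  have "- ((1 / \<alpha>) *\<^sub>R (prox E \<alpha> r u - u)) \<in> subdiff E r (prox E \<alpha> r u)"
    using pE u E by (simp add: subspace_diff)
  then show "(1 / \<alpha>) *\<^sub>R (u - prox E \<alpha> r u) \<in> subdiff E r (prox E \<alpha> r u)"
    by (simp add: algebra_simps)
qed

text \<open>Both sides solve p + \<open>\<alpha>\<close> g' = x + \<open>\<alpha>\<close> g with g'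
  a subgradient at p, and nonexpansiveness of the resolvent leaves only one such p.\<close>

lemma prox_eqI:
  fixes r :: "'a::real_inner \<Rightarrow> ereal"
  assumes E: "subspace E" "complete E"
    and r: "convex_ext E r" "closed_ext E r" "proper_ext E r"
    and g: "g \<in> subdiff E r x" "x \<in> E" and \<alpha>: "\<alpha> > 0"
  shows "prox E \<alpha> r (x + \<alpha> *\<^sub>R g) = x"
proof -
  have "x + \<alpha> *\<^sub>R g \<in> E" using E g by (simp add: subdiff_def subspace_add subspace_scale)
  note p = prox_subgradient[OF E r g \<alpha> this]
  show ?thesis using resolvent_nonexpansive[OF r(3) p(1) g(2) p(2) g(1) \<alpha>] \<alpha> by simp
qed

lemma prox_nonexpansive:
  fixes r :: "'a::real_inner \<Rightarrow> ereal"
  assumes E: "subspace E" "complete E"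
    and r: "convex_ext E r" "closed_ext E r" "proper_ext E r"
    and g: "g \<in> subdiff E r x" "x \<in> E" and \<alpha>: "\<alpha> > 0" and u: "u \<in> E" "u' \<in> E"
  shows "norm (prox E \<alpha> r u - prox E \<alpha> r u') \<le> norm (u - u')"
  using resolvent_nonexpansive[OF r(3) prox_subgradient(1)[OF E r g \<alpha> u(1)]
      prox_subgradient(1)[OF E r g \<alpha> u(2)] prox_subgradient(2)[OF E r g \<alpha> u(1)]
      prox_subgradient(2)[OF E r g \<alpha> u(2)] \<alpha>] \<alpha>
  by simp

text \<open>The projection onto a closed convex set is the proximal map of its indicator function.\<close>

lemma ex_arg_min_norm_subdiff:
  fixes r :: "'a::real_inner \<Rightarrow> ereal"
  assumes E: "subspace E" "complete E"
    and r: "proper_ext E r" and g: "g \<in> subdiff E r x" and x: "x \<in> E"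
  shows "\<exists>g. is_arg_min (\<lambda>g. (norm (w + g))\<^sup>2) (\<lambda>g. g \<in> subdiff E r x) g"
proof -
  define S where "S = subdiff E r x"
  define h where "h = (\<lambda>y. if y \<in> S then 0 else \<infinity> :: ereal)"
  obtain a where a: "r x = ereal a" using subdiff_finite[OF r g x] .
  \<comment> \<open>Rewritten over the reals, the subdifferential is an intersection of
    \<open>E\<close> with closed half-spaces: points where \<open>r\<close> is infinite impose no
    condition.\<close>
  have S_iff: "s \<in> S \<longleftrightarrow> s \<in> E \<and> (\<forall>y\<in>E. \<forall>b. r y = ereal b \<longrightarrow> a + s \<bullet> (y - x) \<le> b)" for s
  proof -
    have "r x + ereal (s \<bullet> (y - x)) \<le> r y \<longleftrightarrow> (\<forall>b. r y = ereal b \<longrightarrow> a + s \<bullet> (y - x) \<le> b)"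
      if "y \<in> E" for y
      using r that by (cases "r y") (auto simp: a proper_ext_def)
    then show ?thesis by (auto simp: S_def subdiff_def)
  qed
  have "convex_ext E h"
    unfolding convex_ext_def
  proof (intro ballI allI impI)
    fix y z and s t :: real assume yz: "y \<in> E" "z \<in> E" and st: "0 \<le> s" "0 \<le> t" "s + t = 1"
    have "s *\<^sub>R y + t *\<^sub>R z \<in> S" if "y \<in> S" "z \<in> S"
      unfolding S_iff
    proof (intro conjI ballI allI impI)
      show "s *\<^sub>R y + t *\<^sub>R z \<in> E" using E(1) yz by (simp add: subspace_add subspace_scale)
      fix w b assume "w \<in> E" "r w = ereal b"
      then have "a + y \<bullet> (w - x) \<le> b" "a + z \<bullet> (w - x) \<le> b"
        using that by (auto simp: S_iff)
      then have "s * (a + y \<bullet> (w - x)) + t * (a + z \<bullet> (w - x)) \<le> b"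
        using convex_bound_le st by blast
      moreover have "s * (a + y \<bullet> (w - x)) + t * (a + z \<bullet> (w - x))
          = (s + t) * a + (s *\<^sub>R y + t *\<^sub>R z) \<bullet> (w - x)"
        by (simp add: inner_add_left algebra_simps)
      ultimately show "a + (s *\<^sub>R y + t *\<^sub>R z) \<bullet> (w - x) \<le> b" by (simp add: st)
    qed
    \<comment> \<open>The zero weights are separated because 0 times infinity is 0 in
      \<open>ereal\<close>: such a weight imposes nothing on its point.\<close>
    then show "h (s *\<^sub>R y + t *\<^sub>R z) \<le> ereal s * h y + ereal t * h z"
      using st by (cases "s = 0"; cases "t = 0") (auto simp: h_def)
  qed
  moreover have "closed S"
    unfolding closed_sequential_limits
  proof (intro allI impI, elim conjE)
    fix X l assume X: "\<forall>n. X n \<in> S" "X \<longlonglongrightarrow> l"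
    show "l \<in> S"
      unfolding S_iff
    proof (intro conjI ballI allI impI)
      show "l \<in> E" using complete_imp_closed[OF E(2)] X
        by (metis closed_sequentially S_iff)
      fix y b assume "y \<in> E" "r y = ereal b"
      then have "a + X n \<bullet> (y - x) \<le> b" for n using X by (auto simp: S_iff)
      moreover have "(\<lambda>n. a + X n \<bullet> (y - x)) \<longlonglongrightarrow> a + l \<bullet> (y - x)"
        by (intro tendsto_intros X)
      ultimately show "a + l \<bullet> (y - x) \<le> b" by (intro LIMSEQ_le_const2) auto
    qed
  qed
  then have "closed (S \<times> {0::real..})" by (intro closed_Times) auto
  moreover have "{(y, t :: real). y \<in> E \<and> h y \<le> ereal t} = S \<times> {0..}"
    by (auto simp: h_def S_iff split: if_splits)
  ultimately have h: "convex_ext E h" "closed_ext E h"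
    by (simp_all add: closed_ext_def)
  have "proper_ext E h" using g by (auto simp: proper_ext_def h_def S_def subdiff_def)
  moreover have "ereal (0 + 0 \<bullet> y) \<le> h y" for y by (simp add: h_def)
  \<comment> \<open>With unit step-size and centre \<open>- w\<close> the objective is half of the
    squared norm of \<open>w + y\<close> on \<open>S\<close>; the zero function is the
    minorant.\<close>
  ultimately obtain p where p: "is_arg_min (\<lambda>y. ereal 1 * h y + ereal (1 / 2 * (norm (y - (- w)))\<^sup>2)) (\<lambda>y. y \<in> E) p"
    using ex_arg_min_proximal[OF E h, of 0 0 1 "- w"] by auto
  have gE: "g \<in> E" "h g = 0" using g by (auto simp: h_def S_def subdiff_def)
  have "p \<in> S"
    using p gE unfolding is_arg_min_def by (auto simp: h_def split: if_splits)
  moreover have "\<not> (norm (w + y))\<^sup>2 < (norm (w + p))\<^sup>2" if "y \<in> S" for y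
    using p that \<open>p \<in> S\<close> unfolding is_arg_min_def S_iff
    by (auto simp: h_def S_iff add.commute)
  ultimately show ?thesis
    unfolding is_arg_min_def S_def by blast
qed

section \<open>Gauss-Seidel sweeps\<close>

text \<open>The difference between the harmonic number and \<open>ln n\<close> decreases in n and
  equals 1 at n = 1.\<close>

lemma sum_inverse_le_ln:
  assumes "n \<ge> 1" shows "(\<Sum>i=1..n. 1 / real i) \<le> ln (real n) + 1"
  using euler_mascheroni_sequence_decreasing[of 1 n] assms by (simp add: harm_def inverse_eq_divide)

text \<open>Cauchy-Schwarz after splitting each norm with the factors
  \<open>sqrt (1 / real i)\<close> and \<open>sqrt (real i)\<close>. The resulting harmonic sum is
  the source of the logarithm in the complexity.\<close>

lemma norm_sum_weighted_le:
  fixes v :: "nat \<Rightarrow> 'a::real_normed_vector"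
  assumes "m \<le> n" "n \<ge> 1"
  shows "(norm (\<Sum>i=1..m. v i))\<^sup>2 \<le> (ln (real n) + 1) * (\<Sum>i=1..n. real i * (norm (v i))\<^sup>2)"
proof -
  have "(norm (\<Sum>i=1..m. v i))\<^sup>2 \<le> (\<Sum>i=1..n. norm (v i))\<^sup>2"
  proof (rule power_mono)
    have "norm (\<Sum>i=1..m. v i) \<le> (\<Sum>i=1..m. norm (v i))" by (rule norm_sum)
    also have "\<dots> \<le> (\<Sum>i=1..n. norm (v i))" using assms by (intro sum_mono2) auto
    finally show "norm (\<Sum>i=1..m. v i) \<le> (\<Sum>i=1..n. norm (v i))" .
  qed simp
  also have "(\<Sum>i=1..n. norm (v i)) = (\<Sum>i=1..n. sqrt (1 / real i) * (sqrt (real i) * norm (v i)))"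
    by (intro sum.cong) (auto simp: real_sqrt_divide)
  also have "\<dots>\<^sup>2 \<le> (\<Sum>i=1..n. (sqrt (1 / real i))\<^sup>2) * (\<Sum>i=1..n. (sqrt (real i) * norm (v i))\<^sup>2)"
    by (rule Cauchy_Schwarz_ineq_sum)
  also have "\<dots> = (\<Sum>i=1..n. 1 / real i) * (\<Sum>i=1..n. real i * (norm (v i))\<^sup>2)"
    by (simp add: power_mult_distrib)
  also have "\<dots> \<le> (ln (real n) + 1) * (\<Sum>i=1..n. real i * (norm (v i))\<^sup>2)"
    using sum_inverse_le_ln[OF assms(2)] by (intro mult_right_mono sum_nonneg) auto
  finally show ?thesis .
qed

lemma norm_average_le:
  fixes v :: "nat \<Rightarrow> 'a::real_normed_vector"
  assumes "n \<ge> 1"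
  shows "(norm ((1 / real n) *\<^sub>R (\<Sum>i=1..n. v i)))\<^sup>2 \<le> 1 / real n * (\<Sum>i=1..n. (norm (v i))\<^sup>2)"
proof -
  have "(norm (\<Sum>i=1..n. v i))\<^sup>2 \<le> (\<Sum>i=1..n. 1 * norm (v i))\<^sup>2"
    by (intro power_mono) (simp_all add: norm_sum)
  also have "\<dots> \<le> (\<Sum>i=1..n. 1\<^sup>2) * (\<Sum>i=1..n. (norm (v i))\<^sup>2)"
    by (rule Cauchy_Schwarz_ineq_sum)
  finally show ?thesis
    using assms by (simp add: power_divide field_simps power2_eq_square)
qed

text \<open>The running mean read at position \<open>j\<close> of a sweep. The inequality is strict
  since block \<open>j\<close> still holds its old value when it is recomputed.\<close>

definition mixed_mean :: "nat \<Rightarrow> (nat \<Rightarrow> 'a::real_vector) \<Rightarrow> (nat \<Rightarrow> 'a) \<Rightarrow> nat \<Rightarrow> 'a" where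
  "mixed_mean n a b j = (1 / real n) *\<^sub>R (\<Sum>i=1..n. if i < j then b i else a i)"

text \<open>
  Summing \<open>n \<parallel>b j - s j\<parallel>\<^sup>2 \<le> (\<Sum>i<j. \<parallel>b i - s i\<parallel>\<^sup>2) + (\<Sum>i\<ge>j. \<parallel>a i - s i\<parallel>\<^sup>2)\<close>
  over \<open>j\<close> counts \<open>\<parallel>b i - s i\<parallel>\<^sup>2\<close> exactly \<open>n - i\<close> times and \<open>\<parallel>a i - s i\<parallel>\<^sup>2\<close> exactly \<open>i\<close> times;
  this is where the weights of the order-specific norm come from.
\<close>

lemma gauss_seidel_weighted_contraction:
  fixes a b s :: "nat \<Rightarrow> 'a::real_normed_vector"
  assumes n: "n \<ge> 1"
    and le: "\<And>j. j \<in> {1..n} \<Longrightarrow> norm (b j - s j) \<le> norm (mixed_mean n a b j - (1 / real n) *\<^sub>R (\<Sum>i=1..n. s i))"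
  shows "(\<Sum>j=1..n. real j * (norm (b j - s j))\<^sup>2) \<le> (\<Sum>j=1..n. real j * (norm (a j - s j))\<^sup>2)"
proof -
  define A B where "A j = (norm (a j - s j))\<^sup>2" and "B j = (norm (b j - s j))\<^sup>2" for j
  have "real n * B j \<le> (\<Sum>i=1..n. if i < j then B i else A i)" if j: "j \<in> {1..n}" for j
  proof -
    have "mixed_mean n a b j - (1 / real n) *\<^sub>R (\<Sum>i=1..n. s i)
        = (1 / real n) *\<^sub>R (\<Sum>i=1..n. if i < j then b i - s i else a i - s i)"
      unfolding mixed_mean_def scaleR_diff_right[symmetric] sum_subtractf[symmetric]
      by (intro arg_cong[of _ _ "(*\<^sub>R) (1 / real n)"] sum.cong) auto
    then have "B j \<le> (norm ((1 / real n) *\<^sub>R (\<Sum>i=1..n. if i < j then b i - s i else a i - s i)))\<^sup>2"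
      unfolding B_def using le[OF j] by (intro power_mono) auto
    also have "\<dots> \<le> 1 / real n * (\<Sum>i=1..n. (norm (if i < j then b i - s i else a i - s i))\<^sup>2)"
      by (rule norm_average_le[OF n])
    also have "(\<Sum>i=1..n. (norm (if i < j then b i - s i else a i - s i))\<^sup>2)
        = (\<Sum>i=1..n. if i < j then B i else A i)"
      by (intro sum.cong) (auto simp: A_def B_def)
    finally show ?thesis using n by (simp add: field_simps)
  qed
  then have "(\<Sum>j=1..n. real n * B j) \<le> (\<Sum>j=1..n. \<Sum>i=1..n. if i < j then B i else A i)"
    by (intro sum_mono)
  also have "\<dots> = (\<Sum>i=1..n. \<Sum>j=1..n. if i < j then B i else A i)"
    by (rule sum.swap)
  also have "\<dots> = (\<Sum>i=1..n. (real n - real i) * B i + real i * A i)"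
  proof (intro sum.cong refl)
    fix i assume i: "i \<in> {1..n}"
    have "{1..n} \<inter> {j. i < j} = {i<..n}" "{1..n} \<inter> - {j. i < j} = {1..i}" using i by auto
    then show "(\<Sum>j=1..n. if i < j then B i else A i) = (real n - real i) * B i + real i * A i"
      using i by (simp add: sum.If_cases of_nat_diff)
  qed
  finally show ?thesis
    by (simp add: A_def B_def left_diff_distrib sum.distrib sum_subtractf)
qed

text \<open>The difference between a Jacobi and a Gauss-Seidel sweep is controlled by the partial sums of \<open>b - a\<close>.\<close>

lemma jacobi_residual_le:
  fixes a b :: "nat \<Rightarrow> 'a::real_normed_vector"
  assumes n: "n \<ge> 1"
    and le: "\<And>j. j \<in> {1..n} \<Longrightarrow> norm (c j - b j) \<le> norm ((1 / real n) *\<^sub>R (\<Sum>i=1..n. a i) - mixed_mean n a b j)"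
  shows "(norm ((1 / real n) *\<^sub>R (\<Sum>j=1..n. c j - a j)))\<^sup>2
    \<le> 4 * (ln (real n) + 1) / real n * (\<Sum>j=1..n. real j / real n * (norm (b j - a j))\<^sup>2)"
proof -
  define Q where "Q = (\<Sum>j=1..n. real j * (norm (b j - a j))\<^sup>2)"
  define M where "M = sqrt ((ln (real n) + 1) * Q)"
  have Q0: "0 \<le> (ln (real n) + 1) * Q"
    using n unfolding Q_def by (intro mult_nonneg_nonneg sum_nonneg) auto
  have part: "norm (\<Sum>i=1..m. b i - a i) \<le> M" if "m \<le> n" for m
    unfolding M_def Q_def using norm_sum_weighted_le[OF that n] by (rule real_le_rsqrt)
  have "norm (c j - b j) \<le> M / real n" if j: "j \<in> {1..n}" for j
  proof -
    \<comment> \<open>The two means differ only through the first \<open>j - 1\<close> blocks,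
      already overwritten, so a partial sum of \<open>b - a\<close> is left.\<close>
    have "mixed_mean n a b j - (1 / real n) *\<^sub>R (\<Sum>i=1..n. a i)
        = (1 / real n) *\<^sub>R (\<Sum>i=1..n. if i \<in> {1..j - 1} then b i - a i else 0)"
      unfolding mixed_mean_def scaleR_diff_right[symmetric] sum_subtractf[symmetric]
      by (intro arg_cong[of _ _ "(*\<^sub>R) (1 / real n)"] sum.cong) auto
    also have "(\<Sum>i=1..n. if i \<in> {1..j - 1} then b i - a i else 0) = (\<Sum>i=1..j - 1. b i - a i)"
      using j by (subst sum.inter_restrict[symmetric]) (auto intro!: sum.cong)
    finally have "norm (c j - b j) \<le> norm ((1 / real n) *\<^sub>R (\<Sum>i=1..j - 1. b i - a i))"
      using le[OF j] by (simp add: norm_minus_commute)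
    also have "\<dots> \<le> 1 / real n * M"
    proof -
      have "norm (\<Sum>i=1..j - 1. b i - a i) \<le> M" using j by (intro part) auto
      then show ?thesis by (simp add: divide_right_mono)
    qed
    finally show ?thesis by simp
  qed
  then have "norm (\<Sum>j=1..n. c j - b j) \<le> (\<Sum>j=1..n. M / real n)"
    by (intro sum_norm_le)
  then have "norm (\<Sum>j=1..n. c j - b j) \<le> M" using n by simp
  \<comment> \<open>Each of the two sums has norm at most \<open>M\<close>; squaring
    2\<open>M\<close> produces the factor 4.\<close>
  moreover have "(\<Sum>j=1..n. c j - a j) = (\<Sum>j=1..n. c j - b j) + (\<Sum>j=1..n. b j - a j)"
    by (simp add: sum.distrib[symmetric])
  ultimately have "norm (\<Sum>j=1..n. c j - a j) \<le> 2 * M"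
    using part[of n] norm_triangle_ineq[of "\<Sum>j=1..n. c j - b j" "\<Sum>j=1..n. b j - a j"] by simp
  then have "norm ((1 / real n) *\<^sub>R (\<Sum>j=1..n. c j - a j)) \<le> 2 * M / real n"
    by (simp add: divide_right_mono)
  then have "(norm ((1 / real n) *\<^sub>R (\<Sum>j=1..n. c j - a j)))\<^sup>2 \<le> (2 * M / real n)\<^sup>2"
    by (rule power_mono) simp
  also have "\<dots> = 4 * ((ln (real n) + 1) * Q) / (real n)\<^sup>2"
    using Q0 by (simp add: M_def power_mult_distrib power_divide)
  also have "\<dots> = 4 * (ln (real n) + 1) / real n * (\<Sum>j=1..n. real j / real n * (norm (b j - a j))\<^sup>2)"
    by (simp add: Q_def sum_divide_distrib[symmetric] power2_eq_square)
  finally show ?thesis .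
qed

text \<open>For damping: the negative last term is the gain that makes the sweep differences
  summable over the epochs.\<close>

lemma norm_convex_combination:
  fixes x y :: "'a::real_inner"
  shows "(norm ((1 - t) *\<^sub>R x + t *\<^sub>R y))\<^sup>2
    = (1 - t) * (norm x)\<^sup>2 + t * (norm y)\<^sup>2 - t * (1 - t) * (norm (y - x))\<^sup>2"
  unfolding power2_norm_eq_inner inner_diff_left inner_diff_right inner_add_left inner_add_right
    inner_scaleR_left inner_scaleR_right inner_commute[of y x]
  by algebra

text \<open>Turns the in-place loop into the implicit Gauss-Seidel equations. The induction carries
  along that the stored mean is the true mean, that positions beyond \<open>m\<close> are untouched
  and that the first \<open>m\<close> positions satisfy their equations.\<close>

lemma fold_inner_step:
  fixes \<pi> :: "nat \<Rightarrow> nat"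
  assumes E: "subspace E" and n: "n \<ge> 1" and \<pi>: "\<pi> permutes {1..n}"
    and S: "\<And>i u. i \<in> {1..n} \<Longrightarrow> u \<in> E \<Longrightarrow>
      prox E \<alpha> r u - \<alpha> *\<^sub>R grad E (f i) (prox E \<alpha> r u) = S i u \<and> S i u \<in> E"
    and z: "\<And>i. i \<in> {1..n} \<Longrightarrow> z i \<in> E"
    and zbar: "zbar = (1 / real n) *\<^sub>R (\<Sum>i=1..n. z i)"
  shows "\<exists>z'. fold (\<lambda>j. inner_step E n \<alpha> f r (\<pi> j)) [1..<n + 1] (z, zbar)
      = (z', (1 / real n) *\<^sub>R (\<Sum>i=1..n. z' i)) \<and>
    (\<forall>i\<in>{1..n}. z' i \<in> E) \<and>
    (\<forall>j\<in>{1..n}. z' (\<pi> j) = S (\<pi> j) (mixed_mean n (z \<circ> \<pi>) (z' \<circ> \<pi>) j))"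
proof -
  have \<pi>_in: "\<pi> j \<in> {1..n} \<longleftrightarrow> j \<in> {1..n}" for j
    using permutes_in_image[OF \<pi>] .
  have \<pi>_inj: "\<pi> i = \<pi> j \<longleftrightarrow> i = j" for i j
    using permutes_inj[OF \<pi>] by (auto dest: injD)
  have mean_\<pi>: "(\<Sum>i=1..n. w i) = (\<Sum>i=1..n. w (\<pi> i))" for w :: "nat \<Rightarrow> 'a"
    using sum.permute[OF \<pi>, of w] by (simp add: o_def)
  have "\<exists>z'. fold (\<lambda>j. inner_step E n \<alpha> f r (\<pi> j)) [1..<m + 1] (z, zbar)
      = (z', (1 / real n) *\<^sub>R (\<Sum>i=1..n. z' i)) \<and>
      (\<forall>i\<in>{1..n}. z' i \<in> E) \<and> (\<forall>j>m. z' (\<pi> j) = z (\<pi> j)) \<and>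
      (\<forall>j\<in>{1..m}. z' (\<pi> j) = S (\<pi> j) (mixed_mean n (z \<circ> \<pi>) (z' \<circ> \<pi>) j))" if "m \<le> n" for m
    using that
  proof (induction m)
    case 0
    show ?case by (rule exI[of _ z]) (auto simp: z zbar)
  next
    case (Suc m)
    from Suc.IH[OF Suc_leD[OF Suc.prems]]
    obtain z' where fold: "fold (\<lambda>j. inner_step E n \<alpha> f r (\<pi> j)) [1..<m + 1] (z, zbar)
        = (z', (1 / real n) *\<^sub>R (\<Sum>i=1..n. z' i))"
      and z'E: "\<And>i. i \<in> {1..n} \<Longrightarrow> z' i \<in> E"
      and old: "\<And>j. j > m \<Longrightarrow> z' (\<pi> j) = z (\<pi> j)"
      and new: "\<And>j. j \<in> {1..m} \<Longrightarrow> z' (\<pi> j) = S (\<pi> j) (mixed_mean n (z \<circ> \<pi>) (z' \<circ> \<pi>) j)"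
      by blast
    define u where "u = (1 / real n) *\<^sub>R (\<Sum>i=1..n. z' i)"
    define p where "p = \<pi> (Suc m)"
    have p: "p \<in> {1..n}" using \<pi>_in[of "Suc m"] Suc.prems by (simp add: p_def)
    have uE: "u \<in> E" unfolding u_def using E z'E by (intro subspace_scale subspace_sum) auto
    define y where "y = z'(p := S p u)"
    have upd: "u + (1 / real n) *\<^sub>R (S p u - z' p) = (1 / real n) *\<^sub>R (\<Sum>i=1..n. y i)"
    proof -
      have "(\<Sum>i=1..n. y i) = S p u + (\<Sum>i\<in>{1..n} - {p}. z' i)"
        using p by (subst sum.remove[of _ p]) (auto simp: y_def)
      moreover have "(\<Sum>i=1..n. z' i) = z' p + (\<Sum>i\<in>{1..n} - {p}. z' i)"
        using p by (subst sum.remove[of _ p]) auto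
      ultimately show ?thesis by (simp add: u_def algebra_simps)
    qed
    have "prox E \<alpha> r u - \<alpha> *\<^sub>R grad E (f p) (prox E \<alpha> r u) = S p u"
      using S[OF p uE] by blast
    then have one: "inner_step E n \<alpha> f r p (z', u) = (y, (1 / real n) *\<^sub>R (\<Sum>i=1..n. y i))"
      by (simp only: inner_step_def Let_def prod.case upd y_def)
    have "fold (\<lambda>j. inner_step E n \<alpha> f r (\<pi> j)) [1..<Suc m + 1] (z, zbar)
        = inner_step E n \<alpha> f r p (fold (\<lambda>j. inner_step E n \<alpha> f r (\<pi> j)) [1..<m + 1] (z, zbar))"
      by (simp add: p_def)
    also have "\<dots> = (y, (1 / real n) *\<^sub>R (\<Sum>i=1..n. y i))"
      unfolding fold u_def[symmetric] by (rule one)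
    finally have step: "fold (\<lambda>j. inner_step E n \<alpha> f r (\<pi> j)) [1..<Suc m + 1] (z, zbar)
        = (y, (1 / real n) *\<^sub>R (\<Sum>i=1..n. y i))" .
    have y_\<pi>: "y (\<pi> j) = (if j = Suc m then S p u else z' (\<pi> j))" for j
      by (auto simp: y_def p_def \<pi>_inj)
    \<comment> \<open>Position \<open>j\<close> reads new blocks only below \<open>j\<close>, so
      overwriting position \<open>Suc m\<close> does not disturb the equations up to there.\<close>
    have mm: "mixed_mean n (z \<circ> \<pi>) (y \<circ> \<pi>) j = mixed_mean n (z \<circ> \<pi>) (z' \<circ> \<pi>) j" if "j \<le> Suc m" for j
      unfolding mixed_mean_def using that
      by (intro arg_cong[of _ _ "(*\<^sub>R) (1 / real n)"] sum.cong) (auto simp: y_\<pi>)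
    \<comment> \<open>From position \<open>Suc m\<close> on, the current blocks are still the old
      ones, so the mixed mean is the stored mean.\<close>
    have "mixed_mean n (z \<circ> \<pi>) (z' \<circ> \<pi>) (Suc m) = u"
      unfolding mixed_mean_def u_def mean_\<pi>[of z']
      by (intro arg_cong[of _ _ "(*\<^sub>R) (1 / real n)"] sum.cong) (auto simp: old)
    then have "\<forall>j\<in>{1..Suc m}. y (\<pi> j) = S (\<pi> j) (mixed_mean n (z \<circ> \<pi>) (y \<circ> \<pi>) j)"
      using new by (auto simp: y_\<pi> mm p_def)
    moreover have "\<forall>i\<in>{1..n}. y i \<in> E" using z'E S[OF p uE] by (simp add: y_def)
    moreover have "\<forall>j>Suc m. y (\<pi> j) = z (\<pi> j)" by (simp add: y_\<pi> old)
    ultimately show ?case using step by blast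
  qed
  from this[OF order_refl] show ?thesis by blast
qed

section \<open>Epochs of the algorithm\<close>

text \<open>Shifting the time window to 1..n makes all epochs the same map of the state.\<close>

lemma epoch_state_Suc_cyclic:
  assumes "cyclic_sampling n \<pi> idx"
  shows "epoch_state E n \<alpha> \<theta> f r idx z0 (Suc k) =
    (let (z, zbar) = epoch_state E n \<alpha> \<theta> f r idx z0 k;
         (z', zbar') = fold (\<lambda>j. inner_step E n \<alpha> f r (\<pi> j)) [1..<n + 1] (z, zbar)
     in (\<lambda>i. (1 - \<theta>) *\<^sub>R z i + \<theta> *\<^sub>R z' i, (1 - \<theta>) *\<^sub>R zbar + \<theta> *\<^sub>R zbar'))"
proof -
  have "[k * n + 1..<(k + 1) * n + 1] = map (\<lambda>j. k * n + j) [1..<n + 1]"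
    by (rule nth_equalityI) (simp_all del: upt_Suc)
  then have "fold (\<lambda>t. inner_step E n \<alpha> f r (idx t)) [k * n + 1..<(k + 1) * n + 1] q
      = fold (\<lambda>j. inner_step E n \<alpha> f r (idx (k * n + j))) [1..<n + 1] q" for q
    by (simp only: fold_map o_def)
  also have "\<dots> q = fold (\<lambda>j. inner_step E n \<alpha> f r (\<pi> j)) [1..<n + 1] q" for q
    using assms by (intro fold_cong refl) (auto simp: cyclic_sampling_def)
  finally show ?thesis by (simp only: epoch_state.simps)
qed

text \<open>The sweep does not increase the weighted distance to \<open>s\<close>, and damping gains
  a multiple of the weighted squared difference \<open>z' - z\<close>, which controls the Jacobi
  residual. That residual uses the mean at the start of the epoch, the point where optimality is
  measured.\<close>

lemma damped_epoch_descent: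
  fixes s z0 :: "nat \<Rightarrow> 'a::real_inner" and \<pi> :: "nat \<Rightarrow> nat"
  assumes E: "subspace E" and n: "n \<ge> 1" and \<pi>: "\<pi> permutes {1..n}"
    and S: "\<And>i u. i \<in> {1..n} \<Longrightarrow> u \<in> E \<Longrightarrow>
      prox E \<alpha> r u - \<alpha> *\<^sub>R grad E (f i) (prox E \<alpha> r u) = S i u \<and> S i u \<in> E"
    and S_le: "\<And>i u v. i \<in> {1..n} \<Longrightarrow> u \<in> E \<Longrightarrow> v \<in> E \<Longrightarrow> norm (S i u - S i v) \<le> norm (u - v)"
    and sE: "\<And>i. i \<in> {1..n} \<Longrightarrow> s i \<in> E"
    and s: "\<And>i. i \<in> {1..n} \<Longrightarrow> S i ((1 / real n) *\<^sub>R (\<Sum>i=1..n. s i)) = s i"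
    and cyc: "cyclic_sampling n \<pi> idx" and \<theta>: "0 < \<theta>" "\<theta> < 1"
    and st: "epoch_state E n \<alpha> \<theta> f r idx z0 k = (z, (1 / real n) *\<^sub>R (\<Sum>i=1..n. z i))"
    and z: "\<And>i. i \<in> {1..n} \<Longrightarrow> z i \<in> E"
  shows "\<exists>w. epoch_state E n \<alpha> \<theta> f r idx z0 (Suc k) = (w, (1 / real n) *\<^sub>R (\<Sum>i=1..n. w i)) \<and>
    (\<forall>i\<in>{1..n}. w i \<in> E) \<and>
    \<theta> * (1 - \<theta>) * (norm ((1 / real n) *\<^sub>R (\<Sum>j=1..n. S j ((1 / real n) *\<^sub>R (\<Sum>i=1..n. z i)) - z j)))\<^sup>2
      \<le> 4 * (ln (real n) + 1) / real n
        * ((order_norm n \<pi> (\<lambda>i. z i - s i))\<^sup>2 - (order_norm n \<pi> (\<lambda>i. w i - s i))\<^sup>2)"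
proof -
  define zbar where "zbar = (1 / real n) *\<^sub>R (\<Sum>i=1..n. z i)"
  have "\<exists>z'. fold (\<lambda>j. inner_step E n \<alpha> f r (\<pi> j)) [1..<n + 1] (z, zbar)
      = (z', (1 / real n) *\<^sub>R (\<Sum>i=1..n. z' i)) \<and>
    (\<forall>i\<in>{1..n}. z' i \<in> E) \<and>
    (\<forall>j\<in>{1..n}. z' (\<pi> j) = S (\<pi> j) (mixed_mean n (z \<circ> \<pi>) (z' \<circ> \<pi>) j))"
    by (rule fold_inner_step[OF E n \<pi>]) (rule S z zbar_def; assumption)+
  then obtain z' where fold: "fold (\<lambda>j. inner_step E n \<alpha> f r (\<pi> j)) [1..<n + 1] (z, zbar)
      = (z', (1 / real n) *\<^sub>R (\<Sum>i=1..n. z' i))"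
    and z'E: "\<And>i. i \<in> {1..n} \<Longrightarrow> z' i \<in> E"
    and gs: "\<And>j. j \<in> {1..n} \<Longrightarrow> z' (\<pi> j) = S (\<pi> j) (mixed_mean n (z \<circ> \<pi>) (z' \<circ> \<pi>) j)"
    by blast
  define w where "w i = (1 - \<theta>) *\<^sub>R z i + \<theta> *\<^sub>R z' i" for i
  have \<pi>_in: "\<pi> j \<in> {1..n}" if "j \<in> {1..n}" for j
    using permutes_in_image[OF \<pi>] that by blast
  have mean_\<pi>: "(\<Sum>i=1..n. v i) = (\<Sum>i=1..n. v (\<pi> i))" for v :: "nat \<Rightarrow> 'a"
    using sum.permute[OF \<pi>, of v] by (simp add: o_def)
  have meanE: "(1 / real n) *\<^sub>R (\<Sum>i=1..n. v i) \<in> E" if "\<And>i. i \<in> {1..n} \<Longrightarrow> v i \<in> E" for v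
    using E that by (intro subspace_scale subspace_sum) auto
  have mixedE: "mixed_mean n (z \<circ> \<pi>) (z' \<circ> \<pi>) j \<in> E" for j
    unfolding mixed_mean_def using z z'E \<pi>_in by (intro meanE) auto
  have state: "epoch_state E n \<alpha> \<theta> f r idx z0 (Suc k) = (w, (1 / real n) *\<^sub>R (\<Sum>i=1..n. w i))"
  proof -
    have "(1 - \<theta>) *\<^sub>R zbar + \<theta> *\<^sub>R ((1 / real n) *\<^sub>R (\<Sum>i=1..n. z' i)) = (1 / real n) *\<^sub>R (\<Sum>i=1..n. w i)"
      by (simp add: w_def zbar_def sum.distrib scaleR_sum_right[symmetric] scaleR_add_right mult.commute)
    then show ?thesis
      unfolding epoch_state_Suc_cyclic[OF cyc] st zbar_def[symmetric]
      by (simp del: upt_Suc add: fold[simplified] w_def[abs_def])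
  qed
  have wE: "w i \<in> E" if "i \<in> {1..n}" for i
    using E z z'E that by (simp add: w_def subspace_add subspace_scale)
  have on: "(order_norm n \<pi> v)\<^sup>2 = (\<Sum>j=1..n. real j / real n * (norm (v (\<pi> j)))\<^sup>2)" for v :: "nat \<Rightarrow> 'a"
    by (simp add: order_norm_def sum_nonneg)
  have contr: "(order_norm n \<pi> (\<lambda>i. z' i - s i))\<^sup>2 \<le> (order_norm n \<pi> (\<lambda>i. z i - s i))\<^sup>2"
  proof -
    \<comment> \<open>Since \<open>S i\<close> maps the mean of \<open>s\<close> to
      \<open>s i\<close>, nonexpansiveness compares the mixed mean with the mean of
      \<open>s\<close>.\<close>
    have "norm ((z' \<circ> \<pi>) j - (s \<circ> \<pi>) j)
        \<le> norm (mixed_mean n (z \<circ> \<pi>) (z' \<circ> \<pi>) j - (1 / real n) *\<^sub>R (\<Sum>i=1..n. (s \<circ> \<pi>) i))"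
      if j: "j \<in> {1..n}" for j
      using S_le[OF \<pi>_in[OF j] mixedE[of j] meanE[of s]] sE
      by (simp add: gs[OF j] s[OF \<pi>_in[OF j]] mean_\<pi>[of s, symmetric] del: One_nat_def)
    from gauss_seidel_weighted_contraction[OF n this]
    show ?thesis
      unfolding on by (simp add: sum_divide_distrib[symmetric] divide_right_mono)
  qed
  have "(norm ((1 / real n) *\<^sub>R (\<Sum>j=1..n. S (\<pi> j) zbar - (z \<circ> \<pi>) j)))\<^sup>2
      \<le> 4 * (ln (real n) + 1) / real n * (\<Sum>j=1..n. real j / real n * (norm ((z' \<circ> \<pi>) j - (z \<circ> \<pi>) j))\<^sup>2)"
  proof (rule jacobi_residual_le[OF n])
    fix j assume j: "j \<in> {1..n}"
    have "zbar \<in> E" unfolding zbar_def using z by (rule meanE)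
    then show "norm (S (\<pi> j) zbar - (z' \<circ> \<pi>) j)
        \<le> norm ((1 / real n) *\<^sub>R (\<Sum>i=1..n. (z \<circ> \<pi>) i) - mixed_mean n (z \<circ> \<pi>) (z' \<circ> \<pi>) j)"
      using S_le[OF \<pi>_in[OF j] _ mixedE[of j]]
      by (simp add: gs[OF j] zbar_def mean_\<pi>[of z, symmetric] del: One_nat_def)
  qed
  then have res: "(norm ((1 / real n) *\<^sub>R (\<Sum>j=1..n. S j zbar - z j)))\<^sup>2
      \<le> 4 * (ln (real n) + 1) / real n * (order_norm n \<pi> (\<lambda>i. z' i - z i))\<^sup>2"
    by (simp add: on mean_\<pi>[of "\<lambda>j. S j zbar - z j", symmetric] del: One_nat_def)
  have "(order_norm n \<pi> (\<lambda>i. w i - s i))\<^sup>2 = (1 - \<theta>) * (order_norm n \<pi> (\<lambda>i. z i - s i))\<^sup>2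
      + \<theta> * (order_norm n \<pi> (\<lambda>i. z' i - s i))\<^sup>2 - \<theta> * (1 - \<theta>) * (order_norm n \<pi> (\<lambda>i. z' i - z i))\<^sup>2"
  proof -
    have pt: "(norm (w i - s i))\<^sup>2 = (1 - \<theta>) * (norm (z i - s i))\<^sup>2 + \<theta> * (norm (z' i - s i))\<^sup>2
        - \<theta> * (1 - \<theta>) * (norm (z' i - z i))\<^sup>2" for i
    proof -
      have "w i - s i = (1 - \<theta>) *\<^sub>R (z i - s i) + \<theta> *\<^sub>R (z' i - s i)"
        by (simp add: w_def algebra_simps)
      then show ?thesis by (simp only: norm_convex_combination) simp
    qed
    show ?thesis
      unfolding on sum_distrib_left sum.distrib[symmetric] sum_subtractf[symmetric]
      by (intro sum.cong refl) (simp add: pt algebra_simps add_divide_distrib diff_divide_distrib)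
  qed
  also have "\<dots> \<le> (1 - \<theta>) * (order_norm n \<pi> (\<lambda>i. z i - s i))\<^sup>2
      + \<theta> * (order_norm n \<pi> (\<lambda>i. z i - s i))\<^sup>2 - \<theta> * (1 - \<theta>) * (order_norm n \<pi> (\<lambda>i. z' i - z i))\<^sup>2"
    using mult_left_mono[OF contr, of \<theta>] \<theta> by simp
  finally have gap: "\<theta> * (1 - \<theta>) * (order_norm n \<pi> (\<lambda>i. z' i - z i))\<^sup>2
      \<le> (order_norm n \<pi> (\<lambda>i. z i - s i))\<^sup>2 - (order_norm n \<pi> (\<lambda>i. w i - s i))\<^sup>2"
    by (simp add: algebra_simps)
  have "\<theta> * (1 - \<theta>) * (norm ((1 / real n) *\<^sub>R (\<Sum>j=1..n. S j zbar - z j)))\<^sup>2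
      \<le> \<theta> * (1 - \<theta>) * (4 * (ln (real n) + 1) / real n * (order_norm n \<pi> (\<lambda>i. z' i - z i))\<^sup>2)"
    using res \<theta> by (intro mult_left_mono) auto
  also have "\<dots> = 4 * (ln (real n) + 1) / real n * (\<theta> * (1 - \<theta>) * (order_norm n \<pi> (\<lambda>i. z' i - z i))\<^sup>2)"
    by simp
  also have "\<dots> \<le> 4 * (ln (real n) + 1) / real n
      * ((order_norm n \<pi> (\<lambda>i. z i - s i))\<^sup>2 - (order_norm n \<pi> (\<lambda>i. w i - s i))\<^sup>2)"
    using gap n by (intro mult_left_mono) auto
  finally show ?thesis using state wE unfolding zbar_def by blast
qed

text \<open>The one-epoch inequalities telescope over the epochs 0, ..., K, and some epoch has at
  most the average residual; hence the factor \<open>Suc K\<close>.\<close>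

lemma best_epoch_residual:
  fixes s z0 :: "nat \<Rightarrow> 'a::real_inner" and \<pi> :: "nat \<Rightarrow> nat"
  assumes E: "subspace E" and n: "n \<ge> 1" and \<pi>: "\<pi> permutes {1..n}"
    and S: "\<And>i u. i \<in> {1..n} \<Longrightarrow> u \<in> E \<Longrightarrow>
      prox E \<alpha> r u - \<alpha> *\<^sub>R grad E (f i) (prox E \<alpha> r u) = S i u \<and> S i u \<in> E"
    and S_le: "\<And>i u v. i \<in> {1..n} \<Longrightarrow> u \<in> E \<Longrightarrow> v \<in> E \<Longrightarrow> norm (S i u - S i v) \<le> norm (u - v)"
    and sE: "\<And>i. i \<in> {1..n} \<Longrightarrow> s i \<in> E"
    and s: "\<And>i. i \<in> {1..n} \<Longrightarrow> S i ((1 / real n) *\<^sub>R (\<Sum>i=1..n. s i)) = s i"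
    and cyc: "cyclic_sampling n \<pi> idx" and \<theta>: "0 < \<theta>" "\<theta> < 1"
    and z0: "\<And>i. i \<in> {1..n} \<Longrightarrow> z0 i \<in> E"
  obtains k z zbar where "k \<le> K" and "epoch_state E n \<alpha> \<theta> f r idx z0 k = (z, zbar)"
    and "zbar = (1 / real n) *\<^sub>R (\<Sum>i=1..n. z i)" and "zbar \<in> E"
    and "\<theta> * (1 - \<theta>) * real (Suc K) * (norm ((1 / real n) *\<^sub>R (\<Sum>j=1..n. S j zbar) - zbar))\<^sup>2
      \<le> 4 * (ln (real n) + 1) / real n * (order_norm n \<pi> (\<lambda>i. z0 i - s i))\<^sup>2"
proof -
  define Z where "Z k = fst (epoch_state E n \<alpha> \<theta> f r idx z0 k)" for k
  define mean where "mean v = (1 / real n) *\<^sub>R (\<Sum>i=1..n. v i)" for v :: "nat \<Rightarrow> 'a"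
  define R where "R k = (norm (mean (\<lambda>j. S j (mean (Z k)) - Z k j)))\<^sup>2" for k
  define D where "D k = (order_norm n \<pi> (\<lambda>i. Z k i - s i))\<^sup>2" for k
  define c where "c = 4 * (ln (real n) + 1) / real n"
  have c: "0 \<le> c" using n by (simp add: c_def)
  have step: "\<exists>w. epoch_state E n \<alpha> \<theta> f r idx z0 (Suc k) = (w, mean w) \<and> (\<forall>i\<in>{1..n}. w i \<in> E) \<and>
      \<theta> * (1 - \<theta>) * (norm (mean (\<lambda>j. S j (mean z) - z j)))\<^sup>2
        \<le> c * ((order_norm n \<pi> (\<lambda>i. z i - s i))\<^sup>2 - (order_norm n \<pi> (\<lambda>i. w i - s i))\<^sup>2)"
    if "epoch_state E n \<alpha> \<theta> f r idx z0 k = (z, mean z)" "\<forall>i\<in>{1..n}. z i \<in> E" for k z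
    unfolding mean_def c_def
    by (rule damped_epoch_descent[OF E n \<pi> _ _ _ _ cyc \<theta> that(1)[unfolded mean_def] that(2)[rule_format]])
      (rule S S_le sE s; assumption)+
  have inv: "epoch_state E n \<alpha> \<theta> f r idx z0 k = (Z k, mean (Z k)) \<and> (\<forall>i\<in>{1..n}. Z k i \<in> E)" for k
  proof (induction k)
    case 0
    show ?case using z0 by (simp add: Z_def mean_def)
  next
    case (Suc k)
    then obtain w where "epoch_state E n \<alpha> \<theta> f r idx z0 (Suc k) = (w, mean w)" "\<And>i. i \<in> {1..n} \<Longrightarrow> w i \<in> E"
      using step by blast
    then show ?case by (simp add: Z_def del: epoch_state.simps)
  qed
  have desc: "\<theta> * (1 - \<theta>) * R k \<le> c * (D k - D (Suc k))" for k
  proof -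
    obtain w where "epoch_state E n \<alpha> \<theta> f r idx z0 (Suc k) = (w, mean w)"
      and "\<theta> * (1 - \<theta>) * R k \<le> c * (D k - (order_norm n \<pi> (\<lambda>i. w i - s i))\<^sup>2)"
      using step[of k "Z k"] inv[of k] unfolding R_def D_def by blast
    moreover from this inv[of "Suc k"] have "w = Z (Suc k)" by (simp del: epoch_state.simps)
    ultimately show ?thesis by (simp add: D_def)
  qed
  have sum: "\<theta> * (1 - \<theta>) * (\<Sum>k\<le>K. R k) \<le> c * (D 0 - D (Suc K))"
  proof (induction K)
    case 0
    show ?case using desc[of 0] by simp
  next
    case (Suc K)
    with desc[of "Suc K"] show ?case by (simp add: algebra_simps)
  qed
  obtain k where k: "k \<le> K" "real (Suc K) * R k \<le> (\<Sum>k\<le>K. R k)"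
  proof (rule ccontr)
    assume "\<not> thesis"
    with that have "\<And>k. k \<in> {..K} \<Longrightarrow> (\<Sum>k\<le>K. R k) / real (Suc K) < R k"
      by (fastforce simp: field_simps not_le)
    then have "(\<Sum>k\<le>K. (\<Sum>k\<le>K. R k) / real (Suc K)) < (\<Sum>k\<le>K. R k)"
      by (intro sum_strict_mono) auto
    then show False by simp
  qed
  have "0 \<le> D (Suc K)" by (simp add: D_def)
  then have "c * (D 0 - D (Suc K)) \<le> c * D 0" using c by (intro mult_left_mono) auto
  moreover have "\<theta> * (1 - \<theta>) * (real (Suc K) * R k) \<le> \<theta> * (1 - \<theta>) * (\<Sum>k\<le>K. R k)"
    using k(2) \<theta> by (intro mult_left_mono) auto
  ultimately have "\<theta> * (1 - \<theta>) * real (Suc K) * R k \<le> c * D 0"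
    using sum by (simp add: mult.assoc)
  moreover have "R k = (norm (mean (\<lambda>j. S j (mean (Z k))) - mean (Z k)))\<^sup>2"
    by (simp add: R_def mean_def sum_subtractf scaleR_diff_right)
  moreover have "D 0 = (order_norm n \<pi> (\<lambda>i. z0 i - s i))\<^sup>2"
    by (simp add: D_def Z_def)
  ultimately have "\<theta> * (1 - \<theta>) * real (Suc K) * (norm (mean (\<lambda>j. S j (mean (Z k))) - mean (Z k)))\<^sup>2
      \<le> c * (order_norm n \<pi> (\<lambda>i. z0 i - s i))\<^sup>2"
    by (simp only:)
  moreover have "mean (Z k) \<in> E"
    unfolding mean_def using E inv[of k] by (intro subspace_scale subspace_sum) auto
  ultimately show thesis
    using that[OF k(1), of "Z k" "mean (Z k)"] inv[of k] unfolding c_def mean_def by blast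
qed

theorem proposition5:
  fixes c\<^sub>1 c\<^sub>2 c\<^sub>3 \<theta> :: real
  assumes "c\<^sub>1 > 0" and "c\<^sub>2 > 0" and "c\<^sub>3 > 0" and "0 < \<theta>" and "\<theta> < 1"
  shows "\<exists>C>0. \<forall>(d::nat) (n::nat) (L::real) (\<alpha>::real) (f :: nat \<Rightarrow> fseq \<Rightarrow> real) (r :: fseq \<Rightarrow> ereal)
           (xs :: fseq) (z0 :: nat \<Rightarrow> fseq) (zs :: nat \<Rightarrow> fseq) (\<pi> :: nat \<Rightarrow> nat) (idx :: nat \<Rightarrow> nat) (\<rho>::real).
      n \<ge> 1 \<longrightarrow> L > 0 \<longrightarrow>
      (\<forall>i\<in>{1..n}. convex_on (Rn d) (f i) \<and> smooth (Rn d) L (f i)) \<longrightarrow>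
      convex_ext (Rn d) r \<longrightarrow> closed_ext (Rn d) r \<longrightarrow> proper_ext (Rn d) r \<longrightarrow>
      is_arg_min (\<lambda>x. ereal (avg_fun n f x) + r x) (\<lambda>x. x \<in> Rn d) xs \<longrightarrow>
      0 < \<alpha> \<longrightarrow> \<alpha> \<le> 2 / L \<longrightarrow>
      zs = z_star (Rn d) \<alpha> f xs \<longrightarrow>
      (\<forall>i\<in>{1..n}. z0 i \<in> Rn d) \<longrightarrow>
      (\<exists>i\<in>{1..n}. z0 i \<noteq> zs i) \<longrightarrow>
      optimal_order n (\<lambda>i. z0 i - zs i) \<pi> \<longrightarrow>
      cyclic_sampling n \<pi> idx \<longrightarrow>
      \<rho> = (order_norm n \<pi> (\<lambda>i. z0 i - zs i))\<^sup>2 / (stacked_norm n (\<lambda>i. z0 i - zs i))\<^sup>2 \<longrightarrow>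
      (1 / real n) * (stacked_norm n (\<lambda>i. z0 i - zs i))\<^sup>2 \<le> c\<^sub>1 \<longrightarrow>
      \<rho> \<le> c\<^sub>2 / real n \<longrightarrow>
      \<alpha> \<ge> c\<^sub>3 / L \<longrightarrow>
      (\<forall>\<epsilon>>0. \<exists>k::nat.
         real (n * k) \<le> C * (ln (real n) + 1) * (L\<^sup>2 / \<epsilon>) \<and>
         (let x = epoch_iterate (Rn d) n \<alpha> \<theta> f r idx z0 k;
              res = (\<lambda>g. (norm (grad (Rn d) (avg_fun n f) x + g))\<^sup>2)
          in \<exists>g. is_arg_min res (\<lambda>g. g \<in> subdiff (Rn d) r x) g \<and> res g \<le> \<epsilon>))"
proof -
  \<comment> \<open>The factor
    \<open>4 * c\<^sub>1 * c\<^sub>2 / (\<theta> * (1 - \<theta>))\<close> comes from the telescoped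
    descent and the bound on the initial weighted distance; \<open>c\<^sub>3\<^sup>2\<close> comes
    from the lower bound on the step-size.\<close>
  define C where "C = 4 * c\<^sub>1 * c\<^sub>2 / (c\<^sub>3\<^sup>2 * (\<theta> * (1 - \<theta>)))"
  have C: "C > 0" using assms by (simp add: C_def)
  show ?thesis
  proof (rule exI[of _ C], rule conjI[OF C], intro allI impI, goal_cases)
    case (1 d n L \<alpha> f r xs z0 zs \<pi> idx \<rho> \<epsilon>)
    note n = 1(1) and L = 1(2) and r = 1(4-6) and xs_min = 1(7) and \<alpha> = 1(8,9) and zs = 1(10)
      and z0 = 1(11) and ne = 1(12) and opt = 1(13) and cyc = 1(14) and \<rho> = 1(15)
      and c1 = 1(16) and c2 = 1(17) and c3 = 1(18) and \<epsilon> = 1(19)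

    \<comment> \<open>Gradients of the components and of their average\<close>
    define E where "E = Rn d"
    define G where "G i = grad E (f i)" for i
    define P where "P = prox E \<alpha> r"
    define S where "S i u = P u - \<alpha> *\<^sub>R G i (P u)" for i u
    define GF where "GF x = (1 / real n) *\<^sub>R (\<Sum>i=1..n. G i x)" for x
    have E: "subspace E" "complete E"
      by (simp_all add: E_def subspace_Rn complete_Rn)
    have r: "convex_ext E r" "closed_ext E r" "proper_ext E r"
      using r by (simp_all add: E_def)
    have cvx: "convex_on E (f i)" and lip: "L-lipschitz_on E (G i)"
      and diff: "f i differentiable_on E" if "i \<in> {1..n}" for i
      using 1(3) that by (auto simp: E_def G_def smooth_def)
    have GE: "G i x \<in> E" and DG: "(f i has_derivative (\<lambda>h. G i x \<bullet> h)) (at x within E)"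
      if "i \<in> {1..n}" "x \<in> E" for i x
      using grad_Rn[of "f i" d x] diff that by (auto simp: E_def G_def)
    have GFE: "GF x \<in> E" if "x \<in> E" for x
      unfolding GF_def using E GE that by (intro subspace_scale subspace_sum) auto
    have DF: "(avg_fun n f has_derivative (\<lambda>h. GF x \<bullet> h)) (at x within E)" if "x \<in> E" for x
      unfolding GF_def using DG that by (intro has_derivative_avg_fun) auto
    have gradF: "grad E (avg_fun n f) x = GF x" if "x \<in> E" for x
      using grad_eqI[OF E(1) that GFE DF] that by blast

    \<comment> \<open>Nonexpansive maps and their fixed point\<close>
    have xsE: "xs \<in> E" using xs_min by (simp add: is_arg_min_def E_def)
    have "is_arg_min (\<lambda>y. ereal 1 * r y + ereal (avg_fun n f y)) (\<lambda>y. y \<in> E) xs"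
      using xs_min by (simp add: E_def add.commute one_ereal_def[symmetric])
    from arg_min_subgradient[OF E(1) r(1,3) _ this GFE[OF xsE] DF[OF xsE]]
    have sub: "- GF xs \<in> subdiff E r xs" by simp
    note P_sub = prox_subgradient[OF E r sub xsE \<alpha>(1), folded P_def]
    have SE: "S i u \<in> E" if "i \<in> {1..n}" "u \<in> E" for i u
      unfolding S_def using E P_sub GE that by (intro subspace_diff subspace_scale) auto
    have S_le: "norm (S i u - S i v) \<le> norm (u - v)" if "i \<in> {1..n}" "u \<in> E" "v \<in> E" for i u v
    proof -
      have "norm (S i u - S i v) \<le> norm (P u - P v)"
        unfolding S_def
        by (rule gradient_step_nonexpansive[OF E(1) _ _ cvx GE DG lip L \<alpha>]) (use that P_sub in auto)
      also have "\<dots> \<le> norm (u - v)"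
        unfolding P_def using that by (intro prox_nonexpansive[OF E r sub xsE \<alpha>(1)])
      finally show ?thesis .
    qed
    have zs_eq: "zs i = xs - \<alpha> *\<^sub>R G i xs" for i
      by (simp add: zs z_star_def G_def E_def)
    \<comment> \<open>The mean of the optimal blocks is a forward gradient step at
      \<open>xs\<close>; as \<open>- GF xs\<close> is a subgradient there, the proximal map returns
      \<open>xs\<close>.\<close>
    have "(1 / real n) *\<^sub>R (\<Sum>i=1..n. zs i) = xs + \<alpha> *\<^sub>R - GF xs"
      using n by (simp add: zs_eq GF_def sum_subtractf scaleR_sum_right[symmetric] scaleR_diff_right
          sum_constant_scaleR mult.commute)
    then have fixp: "S i ((1 / real n) *\<^sub>R (\<Sum>i=1..n. zs i)) = zs i" for i
      using prox_eqI[OF E r sub xsE \<alpha>(1)] by (simp add: S_def P_def zs_eq)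
    have zsE: "zs i \<in> E" if "i \<in> {1..n}" for i
      unfolding zs_eq using E xsE GE that by (intro subspace_diff subspace_scale) auto
    have \<pi>: "\<pi> permutes {1..n}" using opt by (simp add: optimal_order_def is_arg_min_def)

    \<comment> \<open>Initial distance in the order-specific norm\<close>
    define N where "N = stacked_norm n (\<lambda>i. z0 i - zs i)"
    define D where "D = (order_norm n \<pi> (\<lambda>i. z0 i - zs i))\<^sup>2"
    have D_le: "D \<le> c\<^sub>1 * c\<^sub>2"
    proof -
      obtain i where i: "i \<in> {1..n}" "z0 i \<noteq> zs i" using ne by blast
      have "0 < (norm (z0 i - zs i))\<^sup>2" using i by simp
      also have "\<dots> \<le> (\<Sum>i=1..n. (norm (z0 i - zs i))\<^sup>2)"
        using i by (intro member_le_sum) auto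
      \<comment> \<open>Positivity allows the quotient \<open>\<rho>\<close> to be multiplied
        out.\<close>
      finally have N: "0 < N\<^sup>2" by (simp add: N_def stacked_norm_def sum_nonneg)
      have "D = \<rho> * N\<^sup>2" using N \<rho> by (simp add: D_def N_def)
      also have "\<dots> \<le> c\<^sub>2 / real n * N\<^sup>2" using c2 by (intro mult_right_mono) auto
      also have "\<dots> = c\<^sub>2 * (1 / real n * N\<^sup>2)" by simp
      also have "\<dots> \<le> c\<^sub>2 * c\<^sub>1" using c1 assms by (intro mult_left_mono) (auto simp: N_def)
      finally show ?thesis by (simp add: mult.commute)
    qed

    \<comment> \<open>Choice of the number of epochs\<close>
    define \<Lambda> where "\<Lambda> = ln (real n) + 1"
    have \<Lambda>: "\<Lambda> > 0" using n by (simp add: \<Lambda>_def add_nonneg_pos)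
    define q where "q = C * \<Lambda> * L\<^sup>2 / (real n * \<epsilon>)"
    \<comment> \<open>Rounding down serves both goals: \<open>K \<le> q\<close> bounds the cost,
      while the \<open>Suc K\<close> epochs averaged over number at least \<open>q\<close>. If
      \<open>q < 1\<close>, epoch 0 is already accurate enough and costs nothing.\<close>
    define K where "K = nat \<lfloor>q\<rfloor>"
    have q: "0 \<le> q" using C \<Lambda> \<epsilon> by (simp add: q_def)
    have K: "real K \<le> q" "q \<le> real (Suc K)" using q by (simp_all add: K_def) linarith
    obtain k z zbar where k: "k \<le> K" and st: "epoch_state E n \<alpha> \<theta> f r idx z0 k = (z, zbar)"
      and zbar: "zbar = (1 / real n) *\<^sub>R (\<Sum>i=1..n. z i)" "zbar \<in> E"
      and R: "\<theta> * (1 - \<theta>) * real (Suc K) * (norm ((1 / real n) *\<^sub>R (\<Sum>j=1..n. S j zbar) - zbar))\<^sup>2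
        \<le> 4 * \<Lambda> / real n * D"
      unfolding D_def \<Lambda>_def
    proof (rule best_epoch_residual[of E n \<pi> \<alpha> r f S zs idx \<theta> z0])
      show "prox E \<alpha> r u - \<alpha> *\<^sub>R grad E (f i) (prox E \<alpha> r u) = S i u \<and> S i u \<in> E"
        if "i \<in> {1..n}" "u \<in> E" for i u
        using SE that by (simp add: S_def P_def G_def)
    qed (use E n \<pi> S_le zsE fixp cyc assms z0 in \<open>auto simp: E_def\<close>)

    \<comment> \<open>Optimality residual at the selected epoch\<close>
    define x where "x = P zbar"
    define g0 where "g0 = (1 / \<alpha>) *\<^sub>R (zbar - x)"
    have xE: "x \<in> E" and g0: "g0 \<in> subdiff E r x"
      using P_sub zbar(2) by (simp_all add: x_def g0_def)
    define R where "R = (norm ((1 / real n) *\<^sub>R (\<Sum>j=1..n. S j zbar) - zbar))\<^sup>2"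
    \<comment> \<open>The mean of \<open>S j zbar\<close> is x - \<open>\<alpha>\<close>
      \<open>GF x\<close>, so the Jacobi residual is the optimality residual times -
      \<open>\<alpha>\<close>.\<close>
    have "GF x + g0 = - (1 / \<alpha>) *\<^sub>R ((1 / real n) *\<^sub>R (\<Sum>j=1..n. S j zbar) - zbar)"
      using n \<alpha>(1) by (simp add: S_def x_def[symmetric] g0_def GF_def sum_subtractf
          scaleR_sum_right[symmetric] scaleR_diff_right sum_constant_scaleR mult.commute)
    then have "(norm (GF x + g0))\<^sup>2 = (1 / \<alpha>)\<^sup>2 * R"
      by (simp add: R_def power_divide)
    also have "\<dots> \<le> (L / c\<^sub>3)\<^sup>2 * R"
    proof (intro mult_right_mono power_mono)
      show "1 / \<alpha> \<le> L / c\<^sub>3" using c3 \<alpha>(1) L assms by (simp add: field_simps)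
    qed (use \<alpha>(1) in \<open>simp_all add: R_def\<close>)
    also have "\<dots> \<le> \<epsilon>"
    proof -
      have "\<theta> * (1 - \<theta>) * real (Suc K) * R \<le> 4 * \<Lambda> / real n * (c\<^sub>1 * c\<^sub>2)"
        using order_trans[OF R[folded R_def] mult_left_mono[OF D_le]] \<Lambda> by simp
      moreover have "\<theta> * (1 - \<theta>) * q * R \<le> \<theta> * (1 - \<theta>) * real (Suc K) * R"
        using K(2) assms by (intro mult_right_mono mult_left_mono) (auto simp: R_def)
      ultimately have le: "\<theta> * (1 - \<theta>) * q * R \<le> 4 * \<Lambda> / real n * (c\<^sub>1 * c\<^sub>2)" by linarith
      \<comment> \<open>This identity dictates \<open>C\<close>: it turns the bound on the residual
        into exactly \<open>\<epsilon>\<close>.\<close>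
      have eq: "\<theta> * (1 - \<theta>) * q = (4 * \<Lambda> / real n * (c\<^sub>1 * c\<^sub>2)) * ((L / c\<^sub>3)\<^sup>2 / \<epsilon>)"
      proof -
        define t where "t = \<theta> * (1 - \<theta>)"
        have "t > 0" using assms by (simp add: t_def)
        then show ?thesis
          unfolding q_def C_def t_def[symmetric] by (simp add: field_simps)
      qed
      have "(4 * \<Lambda> / real n * (c\<^sub>1 * c\<^sub>2)) * ((L / c\<^sub>3)\<^sup>2 / \<epsilon> * R)
          \<le> (4 * \<Lambda> / real n * (c\<^sub>1 * c\<^sub>2)) * 1"
        using le[unfolded eq] by (simp only: mult.assoc mult_1_right)
      moreover have "0 < 4 * \<Lambda> / real n * (c\<^sub>1 * c\<^sub>2)" using \<Lambda> n assms by simp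
      ultimately have "(L / c\<^sub>3)\<^sup>2 / \<epsilon> * R \<le> 1" by (simp only: mult_le_cancel_left_pos)
      then show ?thesis using \<epsilon> by (simp add: pos_divide_le_eq)
    qed
    finally have g0_le: "(norm (GF x + g0))\<^sup>2 \<le> \<epsilon>" .
    \<comment> \<open>The theorem asks for an attained minimum; \<open>g0\<close> only serves as a
      competitor that bounds it.\<close>
    obtain g where g: "is_arg_min (\<lambda>g. (norm (GF x + g))\<^sup>2) (\<lambda>g. g \<in> subdiff E r x) g"
      using ex_arg_min_norm_subdiff[OF E r(3) g0 xE] by blast
    then have "(norm (GF x + g))\<^sup>2 \<le> (norm (GF x + g0))\<^sup>2"
      using g0 by (auto simp: is_arg_min_def not_less)
    with g0_le have g_le: "(norm (GF x + g))\<^sup>2 \<le> \<epsilon>" by linarith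
    have "real (n * k) \<le> real n * q"
      using k K(1) by (simp add: mult_left_mono)
    also have "\<dots> = C * (ln (real n) + 1) * (L\<^sup>2 / \<epsilon>)"
      using n by (simp add: q_def \<Lambda>_def)
    finally have cost: "real (n * k) \<le> C * (ln (real n) + 1) * (L\<^sup>2 / \<epsilon>)" .
    have "epoch_iterate (Rn d) n \<alpha> \<theta> f r idx z0 k = x"
      using st by (simp add: epoch_iterate_def x_def P_def E_def)
    moreover have "grad (Rn d) (avg_fun n f) x = GF x" using gradF[OF xE] by (simp add: E_def)
    ultimately show ?case
      using cost g g_le by (intro exI[of _ k]) (auto simp: Let_def E_def)
  qed
qed

end
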